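(* For every $\gamma\in\mathbb C$ outside the spectrum of $\mu_1$ on $\ell^2(V)$, the spherical function $\phi(\cdot,v_0\,|\,\gamma)$ is given as follows. If $B(\gamma)\neq\pm1$, then, with $\epsilon(v)=(-1)^{|v|}$, for every $v\in V$ $$\phi(v,v_0\,|\,\gamma)=\kappa(\gamma,\epsilon(v))\left(\frac{B(\gamma)}{\mathfrak q}\right)^{\lfloor |v|/2\rfloor}+\widetilde\kappa(\gamma,\epsilon(v))\left(\frac{\widetilde B(\gamma)}{\mathfrak q}\right)^{\lfloor |v|/2\rfloor},$$ where $$\kappa(\gamma,+1)=\frac{q_+}{(q_++1)(B(\gamma)^2-1)}\Bigl(B(\gamma)-\frac1{\mathfrak q}\Bigr)\Bigl(B(\gamma)+\sqrt{\tfrac{q_-}{q_+}}\Bigr),\qquad \kappa(\gamma,-1)=\kappa(\gamma,+1)\,F^-(\gamma),$$ $$\widetilde\kappa(\gamma,+1)=\frac{q_+}{(q_++1)(\widetilde B(\gamma)^2-1)}\Bigl(\widetilde B(\gamma)-\frac1{\mathfrak q}\Bigr)\Bigl(\widetilde B(\gamma)+\sqrt{\tfrac{q_-}{q_+}}\Bigr),\qquad \widetilde\kappa(\gamma,-1)=\widetilde\kappa(\gamma,+1)\,\widetilde F^-(\gamma).$$ So, for $v$ of either fixed parity, $\mathfrak q^{|v|/2}\phi(v,v_0\,|\,\gamma)$ is a linear combination of $B(\gamma)^{\lfloor |v|/2\rfloor}$ and $\widetilde B(\gamma)^{\lfloor |v|/2\rfloor}$ with coefficients depending only on $\gamma$ and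 the parity. Moreover, $B(\gamma)=1$ if and only if $\gamma=\pm b$, and $$\phi(v,v_0\,|\,\pm b)=\begin{cases}\mathfrak q^{-\frac{|v|}2}\Bigl(1+\frac{q_+}{q_++1}\bigl(1-\frac1{\mathfrak q}\bigr)\bigl(1+\sqrt{\tfrac{q_-}{q_+}}\bigr)\frac{|v|}2\Bigr)&|v|\text{ even},\\[2mm] \mathfrak q^{-\frac{|v|-1}2}\Bigl(\frac{q_++\mathfrak q}{q_++1}+\frac{q_+}{q_++1}\bigl(1-\frac1{\mathfrak q}\bigr)\bigl(1+\sqrt{\tfrac{q_-}{q_+}}\bigr)\frac{|v|-1}2\Bigr)F^-(\pm b)&|v|\text{ odd},\end{cases}$$ where $F^-(\pm b)=\widetilde F^-(\pm b)=\pm\sqrt{\frac{q_++1}{q_+(q_-+1)}}$ and $F^+(\pm b)=\widetilde F^+(\pm b)=\pm\sqrt{\frac{q_-+1}{q_-(q_++1)}}$. Finally, $B(\gamma)=-1$ if and only if $\gamma=\pm a$, and $$\phi(v,v_0\,|\,\pm a)=\begin{cases}(-\mathfrak q)^{-\frac{|v|}2}\Bigl(1+\frac{q_+}{q_++1}\bigl(-1-\frac1{\mathfrak q}\bigr)\bigl(-1+\sqrt{\tfrac{q_-}{q_+}}\bigr)\frac{|v|}2\Bigr)&|v|\text{ even},\\[2mm] (-\mathfrak q)^{-\frac{|v|-1}2}\Bigl(\frac{q_+-\mathfrak q}{q_++1}+\frac{q_+}{q_++1}\bigl(-1-\frac1{\mathfrak q}\bigr)\bigl(-1+\sqrt{\tfrac{q_-}{q_+}}\bigr)\frac{|v|-1}2\Bigr)F^-(\pm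 a)&|v|\text{ odd},\end{cases}$$ where, for $q_+\neq q_-$, $F^-(\pm a)=\widetilde F^-(\pm a)=\pm\sqrt{\frac{q_++1}{q_+(q_-+1)}}\,\operatorname{sign}(q_+-q_-)$ and $F^+(\pm a)=\widetilde F^+(\pm a)=\mp\sqrt{\frac{q_-+1}{q_-(q_++1)}}\,\operatorname{sign}(q_+-q_-)$ (if $q_+=q_-$, so that $a=0$, the factor multiplying $F^-(\pm a)$ is zero and the value for $|v|$ odd is $0$).
   Context: Let $q_+,q_-\ge 2$ be integers, and let $T$ be the semi-homogeneous tree: the infinite tree whose vertex set $V$ is the disjoint union of $V_+$ and $V_-$, each vertex of $V_\pm$ having exactly $q_\pm+1$ neighbors, all in $V_\mp$ ($q_+=q_-$, the homogeneous case, is allowed). Fix $v_0\in V_+$ and write $|v|=\operatorname{dist}(v,v_0)$, $\mathfrak q=\sqrt{q_+q_-}$. The Laplace operator is $\mu_1f(v)=$ the average of $f$ over the neighbors of $v$. For $\gamma\in\mathbb C$, the spherical function $\phi(\cdot,v_0\,|\,\gamma)$ is the unique function on $V$ depending only on $|v|$, with value $1$ at $v_0$, such that $\mu_1\phi=\gamma\phi$. Set $Q(\gamma)=(q_++1)(q_-+1)\gamma^2$, $W(\gamma)=Q(\gamma)^2-2(q_++q_-)Q(\gamma)+(q_+-q_-)^2$, $$a=\frac{|\sqrt{q_+}-\sqrt{q_-}|}{\sqrt{(q_++1)(q_-+1)}},\qquad b=\frac{\sqrt{q_+}+\sqrt{q_-}}{\sqrt{(q_++1)(q_-+1)}},$$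 so that $W$ vanishes exactly at $\pm a,\pm b$. Let $R(\gamma)$ be the determination of $\sqrt{W(\gamma)}$ on $\mathbb C\setminus((-b,-a)\cup(a,b))$, continuous there, holomorphic off $[-b,-a]\cup[a,b]$, and positive for real $\gamma>b$. For $\gamma\ne0$ set $$F^\pm(\gamma)=\frac{Q(\gamma)\mp(q_+-q_-)-R(\gamma)}{2q_\mp(q_\pm+1)\gamma},\qquad \widetilde F^\pm(\gamma)=\frac{Q(\gamma)\mp(q_+-q_-)+R(\gamma)}{2q_\mp(q_\pm+1)\gamma},$$ and $$B(\gamma)=\frac{Q(\gamma)-(q_++q_-)-R(\gamma)}{2\mathfrak q},\qquad \widetilde B(\gamma)=\frac{Q(\gamma)-(q_++q_-)+R(\gamma)}{2\mathfrak q}=B(\gamma)^{-1}$$ (for $\gamma\neq0$ one has $B=\mathfrak q F^+F^-$, $\widetilde B=\mathfrak q\widetilde F^+\widetilde F^-$). *)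

theory Defs
  imports "HOL-Complex_Analysis.Complex_Analysis"
begin

section \<open>Semi-homogeneous trees\<close>

text \<open>The vertex set of a graph is the whole type \<open>'v\<close>; a graph is given by its adjacency
  relation. Cycles have length at least 3, so going back and forth along an edge is not a cycle.\<close>

definition simple_graph :: "('v \<Rightarrow> 'v \<Rightarrow> bool) \<Rightarrow> bool" where
  "simple_graph adj \<longleftrightarrow> symp adj \<and> irreflp adj"

definition has_cycle :: "('v \<Rightarrow> 'v \<Rightarrow> bool) \<Rightarrow> bool" where
  "has_cycle adj \<longleftrightarrow>
     (\<exists>xs. 3 \<le> length xs \<and> distinct xs \<and> successively adj xs \<and> adj (last xs) (hd xs))"

definition is_tree :: "('v \<Rightarrow> 'v \<Rightarrow> bool) \<Rightarrow> bool" where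
  "is_tree adj \<longleftrightarrow> simple_graph adj \<and> (\<forall>u v. adj\<^sup>*\<^sup>* u v) \<and> \<not> has_cycle adj"

definition nbrs :: "('v \<Rightarrow> 'v \<Rightarrow> bool) \<Rightarrow> 'v \<Rightarrow> 'v set" where
  "nbrs adj v = {w. adj v w}"

definition semihomogeneous_tree ::
    "nat \<Rightarrow> nat \<Rightarrow> 'v set \<Rightarrow> 'v set \<Rightarrow> ('v \<Rightarrow> 'v \<Rightarrow> bool) \<Rightarrow> bool" where
  "semihomogeneous_tree qp qm Vp Vm adj \<longleftrightarrow>
     is_tree adj \<and> Vp \<union> Vm = UNIV \<and> Vp \<inter> Vm = {} \<and>
     (\<forall>v\<in>Vp. nbrs adj v \<subseteq> Vm \<and> card (nbrs adj v) = qp + 1) \<and>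
     (\<forall>v\<in>Vm. nbrs adj v \<subseteq> Vp \<and> card (nbrs adj v) = qm + 1)"

definition graph_dist :: "('v \<Rightarrow> 'v \<Rightarrow> bool) \<Rightarrow> 'v \<Rightarrow> 'v \<Rightarrow> nat" where
  "graph_dist adj u v = (LEAST n. (adj ^^ n) u v)"


section \<open>The Laplace operator, its spectrum and the spherical functions\<close>

definition mu1 :: "('v \<Rightarrow> 'v \<Rightarrow> bool) \<Rightarrow> ('v \<Rightarrow> complex) \<Rightarrow> 'v \<Rightarrow> complex" where
  "mu1 adj f v = (\<Sum>w\<in>nbrs adj v. f w) / of_nat (card (nbrs adj v))"

definition l2 :: "('v \<Rightarrow> complex) set" where
  "l2 = {f. (\<lambda>v. (cmod (f v))\<^sup>2) summable_on UNIV}"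

definition l2_norm :: "('v \<Rightarrow> complex) \<Rightarrow> real" where
  "l2_norm f = sqrt (\<Sum>\<^sub>\<infinity>v. (cmod (f v))\<^sup>2)"

definition l2_resolvent_set :: "(('v \<Rightarrow> complex) \<Rightarrow> ('v \<Rightarrow> complex)) \<Rightarrow> complex set" where
  "l2_resolvent_set T = {\<gamma>.
     bij_betw (\<lambda>f v. \<gamma> * f v - T f v) l2 l2 \<and>
     (\<exists>C. \<forall>f\<in>l2. l2_norm f \<le> C * l2_norm (\<lambda>v. \<gamma> * f v - T f v))}"

definition l2_spectrum :: "(('v \<Rightarrow> complex) \<Rightarrow> ('v \<Rightarrow> complex)) \<Rightarrow> complex set" where
  "l2_spectrum T = - l2_resolvent_set T"

text \<open>
  The defining conditions of the spherical function determine it uniquely on a semi-homogeneous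
  tree; on other graphs \<open>spherical\<close> may be junk.
\<close>

definition spherical :: "('v \<Rightarrow> 'v \<Rightarrow> bool) \<Rightarrow> 'v \<Rightarrow> complex \<Rightarrow> 'v \<Rightarrow> complex" where
  "spherical adj v0 \<gamma> = (THE \<phi>.
     (\<forall>u v. graph_dist adj u v0 = graph_dist adj v v0 \<longrightarrow> \<phi> u = \<phi> v) \<and>
     \<phi> v0 = 1 \<and> (\<forall>v. mu1 adj \<phi> v = \<gamma> * \<phi> v))"


section \<open>The explicit functions of the eigenvalue\<close>

definition qq :: "nat \<Rightarrow> nat \<Rightarrow> real" where
  "qq qp qm = sqrt (real qp * real qm)"

definition Q :: "nat \<Rightarrow> nat \<Rightarrow> complex \<Rightarrow> complex" where
  "Q qp qm \<gamma> = (of_nat qp + 1) * (of_nat qm + 1) * \<gamma>\<^sup>2"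

definition W :: "nat \<Rightarrow> nat \<Rightarrow> complex \<Rightarrow> complex" where
  "W qp qm \<gamma> = (Q qp qm \<gamma>)\<^sup>2 - 2 * (of_nat qp + of_nat qm) * Q qp qm \<gamma>
                 + (of_nat qp - of_nat qm)\<^sup>2"

definition edge_a :: "nat \<Rightarrow> nat \<Rightarrow> real" where
  "edge_a qp qm = \<bar>sqrt (real qp) - sqrt (real qm)\<bar> / sqrt ((real qp + 1) * (real qm + 1))"

definition edge_b :: "nat \<Rightarrow> nat \<Rightarrow> real" where
  "edge_b qp qm = (sqrt (real qp) + sqrt (real qm)) / sqrt ((real qp + 1) * (real qm + 1))"

definition open_cut :: "nat \<Rightarrow> nat \<Rightarrow> complex set" where
  "open_cut qp qm = complex_of_real `
     ({- edge_b qp qm <..< - edge_a qp qm} \<union> {edge_a qp qm <..< edge_b qp qm})"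

definition closed_cut :: "nat \<Rightarrow> nat \<Rightarrow> complex set" where
  "closed_cut qp qm = complex_of_real `
     ({- edge_b qp qm .. - edge_a qp qm} \<union> {edge_a qp qm .. edge_b qp qm})"

text \<open>
  \<open>R\<close> is the determination of the square root of \<open>W\<close> that is positive to the right of \<open>b\<close>.
  Its values on \<open>open_cut\<close> are left unspecified.
\<close>

definition sqrt_W :: "nat \<Rightarrow> nat \<Rightarrow> (complex \<Rightarrow> complex) \<Rightarrow> bool" where
  "sqrt_W qp qm R \<longleftrightarrow>
     (\<forall>\<gamma>. \<gamma> \<notin> open_cut qp qm \<longrightarrow> (R \<gamma>)\<^sup>2 = W qp qm \<gamma>) \<and>
     continuous_on (- open_cut qp qm) R \<and>
     R holomorphic_on (- closed_cut qp qm) \<and>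
     (\<forall>x. edge_b qp qm < x \<longrightarrow> (\<exists>y>0. R (complex_of_real x) = complex_of_real y))"

text \<open>A determination as in \<^const>\<open>sqrt_W\<close> exists, so assuming one is not vacuous.\<close>

lemma W_eq: "W qp qm \<gamma> = (Q qp qm \<gamma> - (of_nat qp + of_nat qm))\<^sup>2 - 4 * of_nat qp * of_nat qm"
  by (simp add: W_def power2_eq_square algebra_simps)

lemma Q_in_cut:
  assumes "Q qp qm \<gamma> = of_real x"
    and "(sqrt qp - sqrt qm)\<^sup>2 \<le> x" and "x \<le> (sqrt qp + sqrt qm)\<^sup>2"
  shows "\<gamma> \<in> closed_cut qp qm"
proof -
  define D where "D = (real qp + 1) * (real qm + 1)"
  have D: "D > 0" by (simp add: D_def)
  have x0: "x \<ge> 0" using assms(2) zero_le_power2 order_trans by blast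
  define y where "y = sqrt (x / D)"
  have "of_real D * \<gamma>\<^sup>2 = of_real x" using assms(1) by (simp add: Q_def D_def)
  then have "\<gamma>\<^sup>2 = of_real (x / D)" using D by (simp add: field_simps)
  also have "\<dots> = (of_real y)\<^sup>2"
    using D x0 by (simp add: y_def flip: of_real_power)
  finally have g: "\<gamma> = of_real y \<or> \<gamma> = of_real (- y)" by (simp add: power2_eq_iff)
  have y: "y = sqrt x / sqrt D" by (simp add: y_def real_sqrt_divide)
  have "sqrt ((sqrt qp - sqrt qm)\<^sup>2) \<le> sqrt x" "sqrt x \<le> sqrt ((sqrt qp + sqrt qm)\<^sup>2)"
    using assms(2,3) by (simp_all only: real_sqrt_le_iff)
  then have "\<bar>sqrt qp - sqrt qm\<bar> \<le> sqrt x" "sqrt x \<le> sqrt qp + sqrt qm"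
    by simp_all
  then have "edge_a qp qm \<le> y" "y \<le> edge_b qp qm"
    unfolding edge_a_def edge_b_def y D_def[symmetric]
    using D by (auto intro!: divide_right_mono)
  then show ?thesis using g by (auto simp: closed_cut_def)
qed

lemma edge_squares:
  "(real qp + 1) * (real qm + 1) * (edge_a qp qm)\<^sup>2 = (sqrt qp - sqrt qm)\<^sup>2"
  "(real qp + 1) * (real qm + 1) * (edge_b qp qm)\<^sup>2 = (sqrt qp + sqrt qm)\<^sup>2"
proof -
  have "(real qp + 1) * (real qm + 1) > 0" by simp
  then show "(real qp + 1) * (real qm + 1) * (edge_a qp qm)\<^sup>2 = (sqrt qp - sqrt qm)\<^sup>2"
    "(real qp + 1) * (real qm + 1) * (edge_b qp qm)\<^sup>2 = (sqrt qp + sqrt qm)\<^sup>2"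
    unfolding edge_a_def edge_b_def power_divide by simp_all
qed

lemma sqrt_W_exists:
  assumes "2 \<le> qp" "2 \<le> qm"
  shows "\<exists>R. sqrt_W qp qm R"
proof -
  define s where "s = complex_of_real (real qp + real qm)"
  define p where "p = real qp * real qm"
  define Z where "Z = (\<lambda>\<gamma>. Q qp qm \<gamma> - s)"
  define R where "R = (\<lambda>\<gamma>. Z \<gamma> * csqrt (1 - of_real (4 * p) / (Z \<gamma>)\<^sup>2))"
  have p: "p > 0" using assms by (simp add: p_def)
  have sq: "(sqrt qp - sqrt qm)\<^sup>2 = real qp + real qm - 2 * sqrt p"
           "(sqrt qp + sqrt qm)\<^sup>2 = real qp + real qm + 2 * sqrt p"
    by (simp_all add: power2_eq_square algebra_simps p_def real_sqrt_mult)
  have W: "W qp qm \<gamma> = (Z \<gamma>)\<^sup>2 - of_real (4 * p)" for \<gamma>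
    by (simp add: W_eq Z_def s_def p_def)
  have incut: "\<gamma> \<in> closed_cut qp qm" if "Z \<gamma> = of_real z" "z\<^sup>2 \<le> 4 * p" for \<gamma> z
  proof (rule Q_in_cut)
    show "Q qp qm \<gamma> = of_real (z + real qp + real qm)"
      using that(1) by (simp add: Z_def s_def algebra_simps)
    have "z\<^sup>2 \<le> (2 * sqrt p)\<^sup>2" using that(2) p by (simp add: power_mult_distrib)
    then have "\<bar>z\<bar> \<le> 2 * sqrt p"
      using p by (metis abs_le_square_iff abs_of_nonneg mult_nonneg_nonneg order_less_imp_le
          real_sqrt_gt_zero zero_le_numeral)
    then show "(sqrt qp - sqrt qm)\<^sup>2 \<le> z + real qp + real qm"
      "z + real qp + real qm \<le> (sqrt qp + sqrt qm)\<^sup>2"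
      unfolding sq by linarith+
  qed
  have Z0: "Z \<gamma> \<noteq> 0" if "\<gamma> \<notin> closed_cut qp qm" for \<gamma>
    using incut[of \<gamma> 0] that p by auto
  have slit: "1 - of_real (4 * p) / (Z \<gamma>)\<^sup>2 \<notin> \<real>\<^sub>\<le>\<^sub>0" if "\<gamma> \<notin> closed_cut qp qm" for \<gamma>
  proof
    assume "1 - of_real (4 * p) / (Z \<gamma>)\<^sup>2 \<in> \<real>\<^sub>\<le>\<^sub>0"
    then obtain t where t: "1 - of_real (4 * p) / (Z \<gamma>)\<^sup>2 = of_real t" "t \<le> 0"
      by (auto elim: nonpos_Reals_cases)
    define z where "z = sqrt (4 * p / (1 - t))"
    have "(Z \<gamma>)\<^sup>2 = of_real (4 * p / (1 - t))"
    proof -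
      have "of_real (1 - t) * (Z \<gamma>)\<^sup>2 = of_real (4 * p)"
        using t(1) Z0[OF that] by (simp add: field_simps)
      moreover have "complex_of_real (1 - t) \<noteq> 0" using t(2) by (simp del: of_real_diff)
      ultimately show ?thesis
        by (simp add: eq_divide_eq mult.commute del: of_real_diff)
    qed
    also have "\<dots> = (of_real z)\<^sup>2"
      using p t(2) by (simp add: z_def flip: of_real_power)
    finally have "Z \<gamma> = of_real z \<or> Z \<gamma> = of_real (- z)" by (simp add: power2_eq_iff)
    moreover have "z\<^sup>2 \<le> 4 * p"
    proof -
      have "z\<^sup>2 = 4 * p / (1 - t)" using p t(2) by (simp add: z_def)
      also have "\<dots> \<le> 4 * p" using p t(2) by (simp add: field_simps mult_nonneg_nonpos)
      finally show ?thesis .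
    qed
    ultimately show False using incut that by (metis power2_minus)
  qed
  have R2: "(R \<gamma>)\<^sup>2 = W qp qm \<gamma>" if "Z \<gamma> \<noteq> 0" for \<gamma>
    using that by (simp add: R_def W power_mult_distrib field_simps)
  have edge0: "W qp qm \<gamma> = 0 \<and> Z \<gamma> \<noteq> 0" if cut: "\<gamma> \<in> closed_cut qp qm" "\<gamma> \<notin> open_cut qp qm" for \<gamma>
  proof -
    have ab: "edge_a qp qm \<le> edge_b qp qm"
      unfolding edge_a_def edge_b_def by (intro divide_right_mono) (auto simp: abs_le_iff intro: order_trans[of _ 0])
    have a: "edge_a qp qm \<ge> 0" by (simp add: edge_a_def)
    obtain y where y1: "\<gamma> = of_real y"
      and y2: "y \<in> {- edge_b qp qm .. - edge_a qp qm} \<union> {edge_a qp qm .. edge_b qp qm}"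
      using cut(1) unfolding closed_cut_def by blast
    have y3: "y \<notin> {- edge_b qp qm <..< - edge_a qp qm} \<union> {edge_a qp qm <..< edge_b qp qm}"
      using cut(2) y1 unfolding open_cut_def by blast
    have "\<bar>y\<bar> = edge_a qp qm \<or> \<bar>y\<bar> = edge_b qp qm"
      using y2 y3 a ab by (simp, linarith)
    note y = y1 this
    have D: "(real qp + 1) * (real qm + 1) > 0" by simp
    have Qy: "Q qp qm \<gamma> = of_real ((real qp + 1) * (real qm + 1) * \<bar>y\<bar>\<^sup>2)"
      by (simp add: Q_def y(1))
    have "(real qp + 1) * (real qm + 1) * \<bar>y\<bar>\<^sup>2 = (sqrt qp - sqrt qm)\<^sup>2 \<or>
          (real qp + 1) * (real qm + 1) * \<bar>y\<bar>\<^sup>2 = (sqrt qp + sqrt qm)\<^sup>2"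
      using y(2) edge_squares[of qp qm] by metis
    then have "Z \<gamma> = of_real (- 2 * sqrt p) \<or> Z \<gamma> = of_real (2 * sqrt p)"
      unfolding Z_def s_def Qy sq by (elim disjE; simp only: of_real_diff[symmetric]) simp_all
    then show ?thesis using p unfolding W
      by (auto simp: power_mult_distrib simp flip: of_real_power)
  qed
  have Rdom: "(R \<gamma>)\<^sup>2 = W qp qm \<gamma>" if "\<gamma> \<notin> open_cut qp qm" for \<gamma>
    using R2 Z0 edge0 that by blast
  have hol: "R holomorphic_on (- closed_cut qp qm)"
    unfolding R_def using slit Z0 by (auto simp: Z_def Q_def intro!: holomorphic_intros)
  have cl: "closed (closed_cut qp qm)"
    unfolding closed_cut_def
    by (intro compact_imp_closed compact_continuous_image compact_Un continuous_intros) auto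
  have Wc: "isCont (W qp qm) \<gamma>" for \<gamma>
    unfolding W_def Q_def by (intro continuous_intros)
  have cont: "continuous_on (- open_cut qp qm) R"
    unfolding continuous_on_def
  proof
    fix \<gamma> assume g: "\<gamma> \<in> - open_cut qp qm"
    show "(R \<longlongrightarrow> R \<gamma>) (at \<gamma> within - open_cut qp qm)"
    proof (cases "\<gamma> \<in> closed_cut qp qm")
      case False
      then have "isCont R \<gamma>"
        using hol cl holomorphic_on_imp_continuous_on continuous_on_eq_continuous_at
        by (metis ComplI open_Compl)
      then show ?thesis
        unfolding isCont_def by (rule tendsto_within_subset) simp
    next
      case True
      then have W0: "W qp qm \<gamma> = 0" using edge0 g by auto
      then have R0: "R \<gamma> = 0" using Rdom[of \<gamma>] g by auto
      have "((\<lambda>x. sqrt (cmod (W qp qm x))) \<longlongrightarrow> sqrt (cmod (W qp qm \<gamma>))) (at \<gamma> within - open_cut qp qm)"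
        using Wc[of \<gamma>] unfolding isCont_def
        by (intro tendsto_intros) (auto intro: tendsto_within_subset)
      moreover have "eventually (\<lambda>x. sqrt (cmod (W qp qm x)) = cmod (R x)) (at \<gamma> within - open_cut qp qm)"
        unfolding eventually_at_filter
        by (auto simp: Rdom[symmetric] norm_power)
      ultimately have "((\<lambda>x. cmod (R x)) \<longlongrightarrow> 0) (at \<gamma> within - open_cut qp qm)"
        using W0 by (simp add: tendsto_cong)
      then show ?thesis using R0 by (simp add: tendsto_norm_zero_iff)
    qed
  qed
  have pos: "\<exists>y>0. R (of_real x) = complex_of_real y" if x: "edge_b qp qm < x" for x
  proof -
    define D where "D = (real qp + 1) * (real qm + 1)"
    have D: "D > 0" by (simp add: D_def)
    define z where "z = D * x\<^sup>2 - (real qp + real qm)"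
    have "edge_b qp qm \<ge> 0" by (simp add: edge_b_def)
    then have "(edge_b qp qm)\<^sup>2 < x\<^sup>2" using x by (intro power_strict_mono) auto
    then have "D * (edge_b qp qm)\<^sup>2 < D * x\<^sup>2" using D by simp
    moreover have "D * (edge_b qp qm)\<^sup>2 = (sqrt qp + sqrt qm)\<^sup>2"
      unfolding D_def by (rule edge_squares)
    ultimately have z: "z > 2 * sqrt p" unfolding z_def sq by linarith
    then have z0: "z > 0" using p by (smt (verit) real_sqrt_gt_zero)
    have "(2 * sqrt p)\<^sup>2 < z\<^sup>2" using z p by (intro power_strict_mono) auto
    then have zz: "4 * p < z\<^sup>2" using p by (simp add: power_mult_distrib)
    have Zx: "Z (of_real x) = of_real z" by (simp add: Z_def Q_def s_def z_def D_def)
    have "R (of_real x) = of_real z * csqrt (of_real (1 - 4 * p / z\<^sup>2))"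
      by (simp add: R_def Zx)
    also have "\<dots> = of_real (z * sqrt (1 - 4 * p / z\<^sup>2))"
    proof -
      have "0 \<le> 1 - 4 * p / z\<^sup>2" using zz z0 by (simp add: field_simps)
      then show ?thesis by (simp only: of_real_sqrt of_real_mult)
    qed
    finally show ?thesis using zz z0 by (intro exI[of _ "z * sqrt (1 - 4 * p / z\<^sup>2)"]) simp
  qed
  show ?thesis using Rdom cont hol pos unfolding sqrt_W_def by blast
qed

text \<open>
  The following functions are parameterised by the determination \<open>R\<close>. The functions \<open>F\<close> are
  only meaningful for \<open>\<gamma> \<noteq> 0\<close>.
\<close>

definition Fp :: "nat \<Rightarrow> nat \<Rightarrow> (complex \<Rightarrow> complex) \<Rightarrow> complex \<Rightarrow> complex" where
  "Fp qp qm R \<gamma> = (Q qp qm \<gamma> - (of_nat qp - of_nat qm) - R \<gamma>) / (2 * of_nat qm * (of_nat qp + 1) * \<gamma>)"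

definition Fm :: "nat \<Rightarrow> nat \<Rightarrow> (complex \<Rightarrow> complex) \<Rightarrow> complex \<Rightarrow> complex" where
  "Fm qp qm R \<gamma> = (Q qp qm \<gamma> + (of_nat qp - of_nat qm) - R \<gamma>) / (2 * of_nat qp * (of_nat qm + 1) * \<gamma>)"

definition Fp' :: "nat \<Rightarrow> nat \<Rightarrow> (complex \<Rightarrow> complex) \<Rightarrow> complex \<Rightarrow> complex" where
  "Fp' qp qm R \<gamma> = (Q qp qm \<gamma> - (of_nat qp - of_nat qm) + R \<gamma>) / (2 * of_nat qm * (of_nat qp + 1) * \<gamma>)"

definition Fm' :: "nat \<Rightarrow> nat \<Rightarrow> (complex \<Rightarrow> complex) \<Rightarrow> complex \<Rightarrow> complex" where
  "Fm' qp qm R \<gamma> = (Q qp qm \<gamma> + (of_nat qp - of_nat qm) + R \<gamma>) / (2 * of_nat qp * (of_nat qm + 1) * \<gamma>)"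

definition B :: "nat \<Rightarrow> nat \<Rightarrow> (complex \<Rightarrow> complex) \<Rightarrow> complex \<Rightarrow> complex" where
  "B qp qm R \<gamma> = (Q qp qm \<gamma> - (of_nat qp + of_nat qm) - R \<gamma>) / (2 * of_real (qq qp qm))"

definition B' :: "nat \<Rightarrow> nat \<Rightarrow> (complex \<Rightarrow> complex) \<Rightarrow> complex \<Rightarrow> complex" where
  "B' qp qm R \<gamma> = (Q qp qm \<gamma> - (of_nat qp + of_nat qm) + R \<gamma>) / (2 * of_real (qq qp qm))"

text \<open>
  The second argument of the coefficients \<open>\<kappa>\<close> is the sign \<open>\<epsilon> = \<plusminus>1\<close>.
\<close>

definition kappa :: "nat \<Rightarrow> nat \<Rightarrow> (complex \<Rightarrow> complex) \<Rightarrow> complex \<Rightarrow> int \<Rightarrow> complex" where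
  "kappa qp qm R \<gamma> \<epsilon> =
     of_nat qp / ((of_nat qp + 1) * ((B qp qm R \<gamma>)\<^sup>2 - 1))
       * (B qp qm R \<gamma> - 1 / of_real (qq qp qm))
       * (B qp qm R \<gamma> + of_real (sqrt (real qm / real qp)))
       * (if \<epsilon> = 1 then 1 else Fm qp qm R \<gamma>)"

definition kappa' :: "nat \<Rightarrow> nat \<Rightarrow> (complex \<Rightarrow> complex) \<Rightarrow> complex \<Rightarrow> int \<Rightarrow> complex" where
  "kappa' qp qm R \<gamma> \<epsilon> =
     of_nat qp / ((of_nat qp + 1) * ((B' qp qm R \<gamma>)\<^sup>2 - 1))
       * (B' qp qm R \<gamma> - 1 / of_real (qq qp qm))
       * (B' qp qm R \<gamma> + of_real (sqrt (real qm / real qp)))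
       * (if \<epsilon> = 1 then 1 else Fm' qp qm R \<gamma>)"

end

theory Submission
  imports Defs
begin

text \<open>
  A radial eigenfunction is a sequence in the level, determined by its value at the root through a
  two-term recurrence whose coefficients alternate with the parity. Eliminating the odd levels gives
  \<open>q\<^sub>+ q\<^sub>- x\<^sub>n\<^sub>+\<^sub>2 = (Q - q\<^sub>+ - q\<^sub>-) x\<^sub>n\<^sub>+\<^sub>1 - x\<^sub>n\<close> on the even levels, with characteristic roots \<open>B/q\<close>
  and \<open>B'/q\<close>; the odd levels follow from
  \<open>(q\<^sub>- + 1) \<gamma> F\<^sup>- = 1 + q\<^sub>- B/q\<close>. The double roots \<open>B = \<plusminus>1\<close> are treated together, as the root
  \<open>1/r\<close> with \<open>r = \<plusminus>q\<close>. Since \<open>R\<close> is arbitrary on the open cut, the first claim also needs that the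
  open cut lies in the spectrum.
\<close>

section \<open>Levels, children and spheres\<close>

text \<open>The root is the only vertex all of whose neighbours are children. This affects the
  initial values but not the recurrence, so one second-order equation covers all even levels, and
  \<kappa>, \<kappa>' are the coefficients fixed by the values at levels 0 and 2. Since B B' = 1,
  the two roots coincide exactly when B = \<plusminus>1, where the divisor B^2 - 1 of \<kappa>
  vanishes and a factor linear in the level replaces the second power. Passing from even to odd
  levels divides by \<gamma>; the odd levels at \<gamma> = 0 are therefore treated separately, which
  is also why the edge a = 0 of the homogeneous case stands apart. The edges themselves lie outside
  the open cut, so R^2 = W holds there without any spectral argument.\<close>

locale rooted_semihomogeneous_tree =
  fixes qp qm :: nat
    and Vp Vm :: "'v set"
    and adj :: "'v \<Rightarrow> 'v \<Rightarrow> bool"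
    and v0 :: 'v
  assumes qp: "2 \<le> qp" and qm: "2 \<le> qm"
    and tree: "semihomogeneous_tree qp qm Vp Vm adj"
    and root: "v0 \<in> Vp"
begin

abbreviation level :: "'v \<Rightarrow> nat" where
  "level v \<equiv> graph_dist adj v v0"

text \<open>Number of children of a vertex of positive level n. The root has one child more than
  \<open>branching 0\<close>, but the degree is \<open>Suc (branching n)\<close> at every level, the
  root included.\<close>

definition branching :: "nat \<Rightarrow> nat" where
  "branching n = (if even n then qp else qm)"

definition children :: "'v \<Rightarrow> 'v set" where
  "children v = {w. adj v w \<and> level w = Suc (level v)}"

definition sphere_at :: "nat \<Rightarrow> 'v set" where
  "sphere_at n = {v. level v = n}"

lemma branching_pos: "branching n > 0"
  using qp qm by (simp add: branching_def)

lemma adj_sym: "adj u v \<Longrightarrow> adj v u"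
  using tree unfolding semihomogeneous_tree_def is_tree_def simple_graph_def by (meson sympD)

lemma adj_parity: "adj u v \<Longrightarrow> u \<in> Vp \<longleftrightarrow> v \<notin> Vp"
  using tree unfolding semihomogeneous_tree_def nbrs_def by blast

lemma level_walk: "(adj ^^ level v) v v0"
proof -
  have "adj\<^sup>*\<^sup>* v v0"
    using tree unfolding semihomogeneous_tree_def is_tree_def by blast
  then have "\<exists>n. (adj ^^ n) v v0" by (rule rtranclp_imp_relpowp)
  then show ?thesis unfolding graph_dist_def by (rule LeastI_ex)
qed

lemma level_le: "(adj ^^ n) v v0 \<Longrightarrow> level v \<le> n"
  unfolding graph_dist_def by (rule Least_le)

lemma level_eq_0_iff [simp]: "level v = 0 \<longleftrightarrow> v = v0"
  using level_walk[of v] level_le[of 0 v] by auto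

lemma level_root [simp]: "level v0 = 0"
  by simp

lemma level_adj_le: "adj u v \<Longrightarrow> level u \<le> Suc (level v)"
  by (rule level_le) (rule relpowp_Suc_I2[OF _ level_walk])

lemma ex_parent:
  assumes "level v = Suc n"
  obtains p where "adj v p" "level p = n"
proof -
  obtain p where p: "adj v p" "(adj ^^ n) p v0"
    using level_walk[of v] unfolding assms by (rule relpowp_Suc_E2)
  moreover have "level p = n"
    using level_le[OF p(2)] level_adj_le[OF p(1)] assms by simp
  ultimately show thesis using that by blast
qed

lemma even_level: "v \<in> Vp \<longleftrightarrow> even (level v)"
proof (induction "level v" arbitrary: v)
  case 0
  then show ?case using root level_eq_0_iff[of v] by auto
next
  case (Suc n)
  obtain p where "adj v p" "level p = n" using Suc.hyps(2)[symmetric] by (rule ex_parent)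
  then show ?case using Suc adj_parity[of v p] by (metis even_Suc)
qed

text \<open>Neighbouring levels differ by at most one, and equality is impossible because every edge
  changes side of the bipartition, which \<open>even_level\<close> reads off the level.\<close>

lemma adj_level: "adj u v \<Longrightarrow> level v = Suc (level u) \<or> level u = Suc (level v)"
  using level_adj_le[of u v] level_adj_le[of v u] adj_sym[of u v] adj_parity[of u v]
    even_level[of u] even_level[of v] by (metis le_Suc_eq le_antisym)

text \<open>Closing this path up with a common child of \<open>u\<close> and \<open>v\<close> would give a cycle.\<close>

lemma path_below_level:
  assumes "level u = n" "level v = n" "u \<noteq> v"
  shows "\<exists>xs. distinct (u # xs @ [v]) \<and> successively adj (u # xs @ [v]) \<and> (\<forall>x\<in>set xs. level x < n)"
  using assms
proof (induction n arbitrary: u v)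
  case 0
  then show ?case using level_eq_0_iff by metis
next
  case (Suc n)
  obtain p where p: "adj u p" "level p = n" using Suc.prems(1) by (rule ex_parent)
  obtain p' where p': "adj v p'" "level p' = n" using Suc.prems(2) by (rule ex_parent)
  have lev: "x \<noteq> u" "x \<noteq> v" if "level x \<le> n" for x using that Suc.prems by auto
  show ?case
  proof (cases "p = p'")
    case True
    then show ?thesis
      using p p' Suc.prems adj_sym[OF p'(1)] lev by (intro exI[of _ "[p]"]) auto
  next
    case False
    obtain xs where xs: "distinct (p # xs @ [p'])" "successively adj (p # xs @ [p'])"
      "\<forall>x\<in>set xs. level x < n"
      using Suc.IH[OF p(2) p'(2) False] by blast
    have lt: "level x \<le> n" if "x \<in> set (p # xs @ [p'])" for x
      using that xs(3) p(2) p'(2) by auto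
    have "successively adj (u # (p # xs @ [p']) @ [v])"
      using xs(2) p(1) adj_sym[OF p'(1)] successively_append_iff[of adj "p # xs @ [p']" "[v]"]
      by (simp add: successively_Cons)
    moreover have "distinct (u # (p # xs @ [p']) @ [v])"
    proof -
      have "u \<notin> set (p # xs @ [p'])" "v \<notin> set (p # xs @ [p'])"
        using lt lev by blast+
      then show ?thesis using xs(1) Suc.prems(3) by auto
    qed
    ultimately show ?thesis
      using lt by (intro exI[of _ "p # xs @ [p']"]) (auto simp: less_Suc_eq_le)
  qed
qed

text \<open>Acyclicity enters here. The vertex \<open>w\<close> can be added to the path from
  \<open>u\<close> to \<open>v\<close> because its level exceeds the levels of all vertices on that
  path.\<close>

lemma parent_unique:
  assumes "adj w u" "adj w v" "level w = Suc (level u)" "level w = Suc (level v)"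
  shows "u = v"
proof (rule ccontr)
  assume "u \<noteq> v"
  then obtain xs where xs: "distinct (u # xs @ [v])" "successively adj (u # xs @ [v])"
    "\<forall>x\<in>set xs. level x < level u"
    using path_below_level[of u "level u" v] assms by auto
  have "w \<notin> set (u # xs @ [v])" using xs(3) assms(3,4) by auto
  then have "has_cycle adj"
    unfolding has_cycle_def
    using xs(1,2) assms(1,2) adj_sym[OF assms(2)] by (intro exI[of _ "w # u # xs @ [v]"]) auto
  then show False using tree unfolding semihomogeneous_tree_def is_tree_def by blast
qed

lemma card_nbrs: "card (nbrs adj v) = Suc (branching (level v))"
proof -
  have "v \<in> Vp \<or> v \<in> Vm" using tree unfolding semihomogeneous_tree_def by blast
  then show ?thesis using tree even_level[of v]
    unfolding semihomogeneous_tree_def branching_def by auto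
qed

lemma finite_nbrs: "finite (nbrs adj v)"
  using card_nbrs[of v] by (metis card.infinite nat.distinct(1))

lemma nbrs_root: "nbrs adj v0 = children v0"
proof -
  have "level w = Suc 0" if "adj v0 w" for w using adj_level[OF that] by simp
  then show ?thesis by (auto simp: nbrs_def children_def)
qed

lemma nbrs_parent:
  assumes "adj v p" "level v = Suc (level p)"
  shows "nbrs adj v = insert p (children v)" "p \<notin> children v"
proof -
  have "w = p" if "adj v w" "level w \<noteq> Suc (level v)" for w
  proof (rule parent_unique[OF that(1) assms(1) _ assms(2)])
    show "level v = Suc (level w)" using adj_level[OF that(1)] that(2) by simp
  qed
  then show "nbrs adj v = insert p (children v)"
    using assms(1) unfolding nbrs_def children_def by blast
  show "p \<notin> children v" using assms(2) unfolding children_def by simp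
qed

lemma finite_children: "finite (children v)"
  by (rule finite_subset[OF _ finite_nbrs[of v]]) (auto simp: children_def nbrs_def)

lemma card_children:
  "card (children v) = (if v = v0 then Suc qp else branching (level v))"
proof (cases "v = v0")
  case True
  then show ?thesis using card_nbrs[of v0] level_eq_0_iff[of v0] nbrs_root by (simp add: branching_def)
next
  case False
  then obtain n where n: "level v = Suc n" using level_eq_0_iff[of v] not0_implies_Suc by blast
  then obtain p where p: "adj v p" "level p = n" by (rule ex_parent)
  show ?thesis
    using nbrs_parent[of v p] p n finite_children[of v] card_nbrs[of v] False by simp
qed

section \<open>Sizes of spheres and sums over them\<close>

lemma sphere_0: "sphere_at 0 = {v0}"
  by (auto simp: sphere_at_def)

lemma sphere_Suc: "sphere_at (Suc n) = (\<Union>v\<in>sphere_at n. children v)"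
proof (intro equalityI subsetI)
  fix w assume "w \<in> sphere_at (Suc n)"
  then have w: "level w = Suc n" by (simp add: sphere_at_def)
  then obtain p where p: "adj w p" "level p = n" by (rule ex_parent)
  then show "w \<in> (\<Union>v\<in>sphere_at n. children v)"
    using w adj_sym[of w p] by (auto simp: sphere_at_def children_def)
qed (auto simp: sphere_at_def children_def)

lemma children_disjoint: "u \<noteq> v \<Longrightarrow> children u \<inter> children v = {}"
  using parent_unique adj_sym unfolding children_def by blast

lemma finite_sphere: "finite (sphere_at n)"
  by (induction n) (auto simp: sphere_0 sphere_Suc finite_children)

lemma sum_sphere_Suc: "sum f (sphere_at (Suc n)) = (\<Sum>v\<in>sphere_at n. sum f (children v))"
  unfolding sphere_Suc
  by (rule sum.UNION_disjoint) (auto simp: finite_sphere finite_children dest: children_disjoint)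

lemma card_sphere_Suc:
  "card (sphere_at (Suc n)) = (if n = 0 then Suc qp else branching n) * card (sphere_at n)"
proof -
  have "card (sphere_at (Suc n)) = (\<Sum>v\<in>sphere_at n. card (children v))"
    using sum_sphere_Suc[of "\<lambda>_. 1::nat" n] by simp
  also have "\<dots> = (\<Sum>v\<in>sphere_at n. if n = 0 then Suc qp else branching n)"
    by (intro sum.cong) (auto simp: card_children sphere_at_def)
  finally show ?thesis by simp
qed

text \<open>Two further levels multiply the size by \<open>qp * qm\<close>. The constant 2 absorbs
  the additional child of the root, as qp + 1 \<le> 2 qp.\<close>

lemma card_sphere_even: "card (sphere_at (2 * n)) \<le> 2 * (qp * qm) ^ n"
proof (cases n)
  case (Suc m)
  have "card (sphere_at (2 * Suc m)) = Suc qp * qm * (qp * qm) ^ m"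
  proof (induction m)
    case 0
    then show ?case
      using card_sphere_Suc[of 0] card_sphere_Suc[of 1]
      by (simp add: sphere_0 branching_def numeral_2_eq_2)
  next
    case (Suc m)
    then show ?case
      using card_sphere_Suc[of "2 * Suc m"] card_sphere_Suc[of "Suc (2 * Suc m)"]
      by (simp add: branching_def algebra_simps)
  qed
  also have "\<dots> \<le> (2 * qp) * qm * (qp * qm) ^ m"
    using qp by (intro mult_right_mono) auto
  finally show ?thesis using Suc by (simp add: algebra_simps)
qed (simp add: sphere_0)

text \<open>Double counting of edges: each vertex of the outer sphere contributes its parent and its
  children, and a vertex of the inner sphere is counted once per child. This turns an equation for
  \<open>mu1\<close> of an arbitrary, not necessarily radial, function into a recurrence for its
  sphere sums.\<close>

lemma sum_nbrs_sphere:
  fixes f :: "'v \<Rightarrow> complex"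
  shows "(\<Sum>v\<in>sphere_at (Suc n). sum f (nbrs adj v)) =
    of_nat (if n = 0 then Suc qp else branching n) * sum f (sphere_at n) + sum f (sphere_at (Suc (Suc n)))"
proof -
  have split: "sum f (nbrs adj v) = f u + sum f (children v)" if "v \<in> children u" for u v
    using nbrs_parent[of v u] adj_sym[of u v] that finite_children[of v]
    by (simp add: children_def)
  have "(\<Sum>v\<in>sphere_at (Suc n). sum f (nbrs adj v)) =
      (\<Sum>u\<in>sphere_at n. \<Sum>v\<in>children u. f u + sum f (children v))"
    unfolding sum_sphere_Suc by (intro sum.cong refl) (rule split)
  also have "\<dots> = (\<Sum>u\<in>sphere_at n. of_nat (card (children u)) * f u)
      + (\<Sum>u\<in>sphere_at n. \<Sum>v\<in>children u. sum f (children v))"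
    by (simp add: sum.distrib)
  also have "(\<Sum>u\<in>sphere_at n. of_nat (card (children u)) * f u) =
      of_nat (if n = 0 then Suc qp else branching n) * sum f (sphere_at n)"
    unfolding sum_distrib_left
    by (intro sum.cong) (auto simp: card_children sphere_at_def)
  finally show ?thesis by (simp add: sum_sphere_Suc[of f "Suc n"] sum_sphere_Suc[of "\<lambda>v. sum f (children v)" n])
qed

lemma mu1_radial:
  assumes "\<And>v. \<phi> v = g (level v)"
  shows "mu1 adj \<phi> v =
    (if v = v0 then g 1
     else (g (level v - 1) + of_nat (branching (level v)) * g (Suc (level v)))
            / of_nat (Suc (branching (level v))))"
proof -
  have ch: "sum \<phi> (children v) = of_nat (card (children v)) * g (Suc (level v))"
    by (simp add: assms children_def)
  show ?thesis
  proof (cases "v = v0")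
    case True
    then show ?thesis
      using ch nbrs_root card_nbrs[of v0] card_children[of v0] level_eq_0_iff[of v0]
      unfolding mu1_def by (simp add: branching_def del: of_nat_Suc)
  next
    case False
    then obtain n where n: "level v = Suc n" using level_eq_0_iff[of v] not0_implies_Suc by blast
    then obtain p where p: "adj v p" "level p = n" by (rule ex_parent)
    have "sum \<phi> (nbrs adj v) = \<phi> p + sum \<phi> (children v)"
      using nbrs_parent[of v p] p n finite_children[of v] by simp
    then show ?thesis
      unfolding mu1_def card_nbrs ch using False card_children[of v] n p assms by simp
  qed
qed

end

section \<open>The open cut and the spectrum\<close>

text \<open>The characteristic roots are conjugate and of modulus one, so the recurrence preserves
  the quadratic form \<open>E\<close>. Being constant and tending to 0, \<open>E\<close> vanishes,
  and it is positive definite.\<close>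

lemma elliptic_recurrence_tendsto_0:
  fixes x :: "nat \<Rightarrow> real"
  assumes rec: "\<And>n. x (Suc (Suc n)) = 2 * c * x (Suc n) - x n"
    and c: "\<bar>c\<bar> < 1" and lim: "x \<longlonglongrightarrow> 0"
  shows "x n = 0"
proof -
  define E where "E = (\<lambda>n. (x n)\<^sup>2 + (x (Suc n))\<^sup>2 - 2 * c * x n * x (Suc n))"
  have "E (Suc n) = E n" for n
    by (simp add: E_def rec power2_eq_square algebra_simps)
  then have E: "E n = E 0" for n by (induction n) simp_all
  have lim': "(\<lambda>n. x (Suc n)) \<longlonglongrightarrow> 0" using lim by (rule LIMSEQ_Suc)
  have "E \<longlonglongrightarrow> 0\<^sup>2 + 0\<^sup>2 - 2 * c * 0 * 0"
    unfolding E_def by (intro tendsto_intros lim lim')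
  moreover have "E = (\<lambda>n. E 0)" using E by (rule ext)
  ultimately have "(\<lambda>n. E 0) \<longlonglongrightarrow> 0" by simp
  then have "E n = 0" using E[of n] LIMSEQ_const_iff by metis
  \<comment> \<open>Completing the square shows definiteness, since 1 - c^2 > 0.\<close>
  moreover have "E n = (x (Suc n) - c * x n)\<^sup>2 + (1 - c\<^sup>2) * (x n)\<^sup>2"
    by (simp add: E_def power2_eq_square algebra_simps)
  moreover have "1 - c\<^sup>2 > 0" using c by (simp add: abs_square_less_1)
  ultimately have "(1 - c\<^sup>2) * (x n)\<^sup>2 \<le> 0" using zero_le_power2[of "x (Suc n) - c * x n"] by linarith
  then show ?thesis using \<open>1 - c\<^sup>2 > 0\<close> by (simp add: mult_le_0_iff)
qed

lemma elliptic_recurrence_tendsto_0_complex: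
  fixes h :: "nat \<Rightarrow> complex"
  assumes rec: "\<And>n. h (Suc (Suc n)) = of_real (2 * c) * h (Suc n) - h n"
    and c: "\<bar>c\<bar> < 1" and lim: "h \<longlonglongrightarrow> 0"
  shows "h n = 0"
proof (rule complex_eqI)
  have "Re (h n) = 0"
    by (rule elliptic_recurrence_tendsto_0[OF _ c]) (use rec tendsto_Re[OF lim] in simp_all)
  then show "Re (h n) = Re 0" by simp
  have "Im (h n) = 0"
    by (rule elliptic_recurrence_tendsto_0[OF _ c]) (use rec tendsto_Im[OF lim] in simp_all)
  then show "Im (h n) = Im 0" by simp
qed

lemma qq_power2: "(qq qp qm)\<^sup>2 = real qp * real qm"
  by (simp add: qq_def)

lemma qq_pos: "qp > 0 \<Longrightarrow> qm > 0 \<Longrightarrow> qq qp qm > 0"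
  by (simp add: qq_def)

lemma of_real_qq_square:
  "complex_of_real (qq qp qm) * complex_of_real (qq qp qm) = of_nat qp * of_nat qm"
proof -
  have "qq qp qm * qq qp qm = real qp * real qm" by (simp add: qq_def)
  then show ?thesis by (metis of_real_mult of_real_of_nat_eq)
qed

text \<open>The squared edges confine Q strictly between qp + qm - 2q and qp + qm + 2q. Thus 2c is
  the sum of two characteristic roots with product 1, and |c| < 1 puts them on the unit
  circle.\<close>

lemma open_cutE:
  assumes "\<gamma> \<in> open_cut qp qm" "qp > 0" "qm > 0"
  obtains c where "\<bar>c\<bar> < 1" "Q qp qm \<gamma> = of_real (real qp + real qm + 2 * c * qq qp qm)" "\<gamma> \<noteq> 0"
proof -
  obtain y where y: "\<gamma> = of_real y"
    "y \<in> {- edge_b qp qm <..< - edge_a qp qm} \<union> {edge_a qp qm <..< edge_b qp qm}"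
    using assms(1) unfolding open_cut_def by blast
  have a: "edge_a qp qm \<ge> 0" by (simp add: edge_a_def)
  have ay: "edge_a qp qm < \<bar>y\<bar>" "\<bar>y\<bar> < edge_b qp qm" using y(2) a by auto
  define D where "D = (real qp + 1) * (real qm + 1)"
  have D: "D > 0" by (simp add: D_def)
  have q: "qq qp qm > 0" using assms by (simp add: qq_pos)
  have "(edge_a qp qm)\<^sup>2 < y\<^sup>2" "y\<^sup>2 < (edge_b qp qm)\<^sup>2"
    using power_strict_mono[OF ay(1) a, of 2] power_strict_mono[OF ay(2), of 2] by simp_all
  then have "D * (edge_a qp qm)\<^sup>2 < D * y\<^sup>2" "D * y\<^sup>2 < D * (edge_b qp qm)\<^sup>2"
    using D by simp_all
  then have "(sqrt qp - sqrt qm)\<^sup>2 < D * y\<^sup>2" "D * y\<^sup>2 < (sqrt qp + sqrt qm)\<^sup>2"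
    unfolding D_def edge_squares by simp_all
  then have lt: "- 2 * qq qp qm < D * y\<^sup>2 - (real qp + real qm)" "D * y\<^sup>2 - (real qp + real qm) < 2 * qq qp qm"
    by (simp_all add: qq_def real_sqrt_mult power2_diff power2_sum)
  define c where "c = (D * y\<^sup>2 - (real qp + real qm)) / (2 * qq qp qm)"
  have c: "\<bar>c\<bar> < 1" using lt q by (simp add: c_def abs_less_iff field_simps)
  have "D * y\<^sup>2 = real qp + real qm + 2 * c * qq qp qm" using q by (simp add: c_def field_simps)
  moreover have "Q qp qm \<gamma> = of_real (D * y\<^sup>2)" by (simp add: Q_def y(1) D_def)
  ultimately show thesis using that[OF c] y(1) ay(1) a by auto
qed

text \<open>Elimination of \<open>x1\<close> and \<open>x3\<close>: insert the second relation into
  the third, then recognise the first in what remains. In this version, for sphere sums, the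
  branching numbers multiply the oldest term.\<close>

lemma alternating_recurrence:
  fixes m p g :: "'a::comm_ring_1"
  assumes "x2 = (m + 1) * g * x1 - p * x0" "x3 = (p + 1) * g * x2 - m * x1"
    "x4 = (m + 1) * g * x3 - p * x2"
  shows "x4 = ((p + 1) * (m + 1) * g\<^sup>2 - p - m) * x2 - p * m * x0"
proof -
  have "x4 = (p + 1) * (m + 1) * g\<^sup>2 * x2 - m * ((m + 1) * g * x1 - p * x0) - p * x2 - p * m * x0"
    unfolding assms(3) assms(2) by (simp add: algebra_simps power2_eq_square)
  also have "(m + 1) * g * x1 - p * x0 = x2" by (rule assms(1)[symmetric])
  finally show ?thesis by (simp add: algebra_simps)
qed

section \<open>The radial eigenfunction, and the obstruction to a resolvent on the open cut\<close>

context rooted_semihomogeneous_tree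
begin

text \<open>The eigenvalue equation at level \<open>Suc n\<close>, solved for the next level. The
  value \<gamma> at level 1 is the equation at the root.\<close>

fun radial_seq :: "complex \<Rightarrow> nat \<Rightarrow> complex" where
  "radial_seq \<gamma> 0 = 1"
| "radial_seq \<gamma> (Suc 0) = \<gamma>"
| "radial_seq \<gamma> (Suc (Suc n)) =
     (of_nat (Suc (branching (Suc n))) * \<gamma> * radial_seq \<gamma> (Suc n) - radial_seq \<gamma> n)
       / of_nat (branching (Suc n))"

lemma radial_eigenfunction_unique:
  assumes rad: "\<And>u v. level u = level v \<Longrightarrow> \<phi> u = \<phi> v"
    and one: "\<phi> v0 = 1" and eig: "\<And>v. mu1 adj \<phi> v = \<gamma> * \<phi> v"
  shows "\<phi> v = radial_seq \<gamma> (level v)"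
proof (induction "level v" arbitrary: v rule: less_induct)
  case less
  \<comment> \<open>The choice of representative does not matter, by \<open>rad\<close>;
    \<open>g\<close> puts \<phi> into the form that \<open>mu1_radial\<close> expects.\<close>
  define g where "g n = \<phi> (SOME v. level v = n)" for n
  have g: "\<phi> v = g (level v)" for v
    unfolding g_def by (rule rad) (metis (mono_tags, lifting) someI)
  note mu = mu1_radial[of \<phi> g, OF g]
  consider "level v = 0" | "level v = 1" | n where "level v = Suc (Suc n)"
    by (metis One_nat_def not0_implies_Suc)
  then show ?case
  proof cases
    case 1
    then show ?thesis using one by simp
  next
    case 2
    then show ?thesis using g[of v] mu[of v0] eig[of v0] one by simp
  next
    case 3
    \<comment> \<open>The eigenvalue equation at the parent \<open>p\<close> expresses the value at
      \<open>v\<close> through those at \<open>p\<close> and at the grandparent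
      \<open>p'\<close>.\<close>
    obtain p where p: "adj v p" "level p = Suc n" using 3 by (rule ex_parent)
    obtain p' where p': "adj p p'" "level p' = n" using p(2) by (rule ex_parent)
    define k where "k = branching (Suc n)"
    have k: "(of_nat k :: complex) \<noteq> 0" "(of_nat (Suc k) :: complex) \<noteq> 0"
      using branching_pos[of "Suc n"] by (simp_all add: k_def del: of_nat_Suc)
    have "p \<noteq> v0" using p(2) by auto
    then have "(\<phi> p' + of_nat k * \<phi> v) / of_nat (Suc k) = \<gamma> * \<phi> p"
      using mu[of p] eig[of p] p(2) p'(2) 3 g[of v] g[of p'] by (simp add: k_def)
    then have "\<phi> v = (of_nat (Suc k) * \<gamma> * \<phi> p - \<phi> p') / of_nat k"
      using k by (simp add: field_simps del: of_nat_Suc)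
    moreover have "\<phi> p = radial_seq \<gamma> (Suc n)" "\<phi> p' = radial_seq \<gamma> n"
      using less[of p] less[of p'] p p' 3 by simp_all
    ultimately show ?thesis using 3 by (simp add: k_def)
  qed
qed

lemma mu1_radial_seq:
  "mu1 adj (\<lambda>v. radial_seq \<gamma> (level v)) v = \<gamma> * radial_seq \<gamma> (level v)"
proof (cases "level v")
  case 0
  then show ?thesis by (subst mu1_radial[where g = "radial_seq \<gamma>"]) simp_all
next
  case (Suc n)
  define k where "k = branching (Suc n)"
  have k: "(of_nat k :: complex) \<noteq> 0" "(of_nat (Suc k) :: complex) \<noteq> 0"
    using branching_pos[of "Suc n"] by (simp_all add: k_def del: of_nat_Suc)
  have "v \<noteq> v0" using Suc by auto
  then show ?thesis
    using k by (subst mu1_radial[where g = "radial_seq \<gamma>"])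
      (simp_all add: Suc field_simps del: of_nat_Suc flip: k_def)
qed

lemma spherical_eq: "spherical adj v0 \<gamma> v = radial_seq \<gamma> (level v)"
proof -
  have "spherical adj v0 \<gamma> = (\<lambda>v. radial_seq \<gamma> (level v))"
    unfolding spherical_def
  proof (rule the_equality)
    show "(\<forall>u v. level u = level v \<longrightarrow> radial_seq \<gamma> (level u) = radial_seq \<gamma> (level v)) \<and>
      radial_seq \<gamma> (level v0) = 1 \<and>
      (\<forall>v. mu1 adj (\<lambda>v. radial_seq \<gamma> (level v)) v = \<gamma> * radial_seq \<gamma> (level v))"
      using mu1_radial_seq by simp
  qed (rule ext, rule radial_eigenfunction_unique, blast+)
  then show ?thesis by simp
qed

text \<open>By Cauchy-Schwarz the squared sum is at most the size of the sphere, bounded by 2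
  q^(2n), times the l2 mass \<open>A\<close> of the sphere. The masses of disjoint spheres have a
  convergent sum, so they tend to 0.\<close>

lemma sphere_sums_tendsto_0:
  assumes f: "f \<in> l2"
  shows "(\<lambda>n. sum f (sphere_at (2 * n)) / of_real (qq qp qm) ^ n) \<longlonglongrightarrow> 0"
proof -
  define A where "A n = (\<Sum>v\<in>sphere_at n. (cmod (f v))\<^sup>2)" for n
  have f': "(\<lambda>v. (cmod (f v))\<^sup>2) summable_on UNIV" using f by (simp add: l2_def)
  have "sum A {..<N} \<le> (\<Sum>\<^sub>\<infinity>v. (cmod (f v))\<^sup>2)" for N
  proof -
    have "sum A {..<N} = (\<Sum>v\<in>(\<Union>n\<in>{..<N}. sphere_at n). (cmod (f v))\<^sup>2)"
      unfolding A_def by (rule sum.UNION_disjoint[symmetric]) (auto simp: finite_sphere, auto simp: sphere_at_def)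
    also have "\<dots> \<le> (\<Sum>\<^sub>\<infinity>v. (cmod (f v))\<^sup>2)"
      using f' by (intro finite_sum_le_infsum) (auto simp: finite_sphere)
    finally show ?thesis .
  qed
  then have "summable A"
    by (intro summableI_nonneg_bounded) (auto simp: A_def sum_nonneg)
  then have "A \<longlonglongrightarrow> 0" by (rule summable_LIMSEQ_zero)
  then have "(\<lambda>n. A (2 * n)) \<longlonglongrightarrow> 0"
    using LIMSEQ_subseq_LIMSEQ[of A 0 "\<lambda>n. 2 * n"] by (simp add: strict_mono_def o_def)
  then have "(\<lambda>n. sqrt (2 * A (2 * n))) \<longlonglongrightarrow> sqrt (2 * 0)"
    by (intro tendsto_intros)
  then have lim: "(\<lambda>n. sqrt (2 * A (2 * n))) \<longlonglongrightarrow> 0" by simp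
  have q: "qq qp qm > 0" using qp qm by (simp add: qq_pos)
  have bound: "cmod (sum f (sphere_at (2 * n)) / of_real (qq qp qm) ^ n) \<le> sqrt (2 * A (2 * n))" for n
  proof -
    define S where "S = sphere_at (2 * n)"
    have q2: "((qq qp qm) ^ n)\<^sup>2 = (real qp * real qm) ^ n"
      by (simp add: qq_power2 flip: power_mult power_even_eq) (metis mult.commute power_mult qq_power2)
    have "(cmod (sum f S))\<^sup>2 \<le> (\<Sum>v\<in>S. cmod (f v))\<^sup>2"
      by (intro power_mono sum_norm_le) auto
    also have "\<dots> \<le> A (2 * n) * real (card S)"
      unfolding A_def S_def by (rule sum_squared_le_sum_of_squares)
    also have "\<dots> \<le> A (2 * n) * real (2 * (qp * qm) ^ n)"
      using card_sphere_even[of n] unfolding S_def A_def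
      by (intro mult_left_mono sum_nonneg) (simp_all only: of_nat_le_iff zero_le_power2)
    also have "\<dots> = (sqrt (2 * A (2 * n)) * qq qp qm ^ n)\<^sup>2"
      unfolding power_mult_distrib q2 by (simp add: A_def sum_nonneg)
    finally have "cmod (sum f S) \<le> sqrt (2 * A (2 * n)) * qq qp qm ^ n"
      using q by (intro power2_le_imp_le[of "cmod (sum f S)"]) (auto simp: A_def sum_nonneg)
    then show ?thesis
      using q by (simp add: S_def norm_divide norm_power field_simps)
  qed
  show ?thesis by (rule Lim_null_comparison[OF _ lim]) (use bound in auto)
qed

text \<open>If \<open>\<gamma>\<close> in the open cut were not in the spectrum, the resolvent would be defined at
  \<open>\<delta>\<close>, the indicator function of \<open>v0\<close>. The sums of \<open>(\<gamma> - \<mu>\<^sub>1)\<^sup>-\<^sup>1 \<delta>\<close> over the spheres of even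
  radius, normalised by the square root of the size of the sphere, tend to zero and satisfy a
  recurrence with unimodular characteristic roots, so they vanish.\<close>

lemma open_cut_subset_spectrum:
  assumes cut: "\<gamma> \<in> open_cut qp qm"
  shows "\<gamma> \<in> l2_spectrum (mu1 adj)"
proof (rule ccontr)
  assume "\<gamma> \<notin> l2_spectrum (mu1 adj)"
  then have bij: "bij_betw (\<lambda>f v. \<gamma> * f v - mu1 adj f v) l2 l2"
    unfolding l2_spectrum_def l2_resolvent_set_def by simp
  define \<delta> where "\<delta> = (\<lambda>v. if v = v0 then 1 else 0 :: complex)"
  have "(\<lambda>v. (cmod (\<delta> v))\<^sup>2) summable_on {v0}" by (rule summable_on_finite) simp
  then have "(\<lambda>v. (cmod (\<delta> v))\<^sup>2) summable_on UNIV"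
    by (rule summable_on_cong_neutral[THEN iffD1, rotated -1]) (auto simp: \<delta>_def)
  then have "\<delta> \<in> l2" by (simp add: l2_def)
  \<comment> \<open>Surjectivity on l2 provides a preimage of \<delta>.\<close>
  then obtain f where f: "f \<in> l2" "\<delta> = (\<lambda>v. \<gamma> * f v - mu1 adj f v)"
    using bij_betw_imp_surj_on[OF bij] by blast
  have eq: "sum f (nbrs adj v) = of_nat (Suc (branching (level v))) * (\<gamma> * f v - \<delta> v)" for v
  proof -
    have "(of_nat (Suc (branching (level v))) :: complex) \<noteq> 0" by (simp del: of_nat_Suc)
    then show ?thesis by (simp add: f(2) mu1_def card_nbrs del: of_nat_Suc)
  qed
  \<comment> \<open>The root has one child more than the other vertices of even level; the factor at \<open>n = 0\<close>
    makes the recurrence uniform.\<close>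
  define t where "t n = (if n = 0 then of_nat (Suc qp) / of_nat qp else 1) * sum f (sphere_at n)" for n
  have t1: "t 1 = of_nat (Suc qp) * (\<gamma> * f v0 - 1)"
    using eq[of v0] nbrs_root sum_sphere_Suc[of f 0]
    by (simp add: t_def sphere_0 \<delta>_def branching_def)
  \<comment> \<open>On spheres of positive radius \<delta> vanishes, so the recurrence is
    homogeneous; the source at the root is visible only in \<open>t1\<close>.\<close>
  have rec: "t (Suc (Suc n)) = of_nat (Suc (branching (Suc n))) * \<gamma> * t (Suc n) - of_nat (branching n) * t n" for n
  proof -
    have "(\<Sum>v\<in>sphere_at (Suc n). sum f (nbrs adj v)) =
      (\<Sum>v\<in>sphere_at (Suc n). of_nat (Suc (branching (Suc n))) * \<gamma> * f v)"
      by (intro sum.cong refl) (auto simp: eq \<delta>_def sphere_at_def)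
    also have "\<dots> = of_nat (Suc (branching (Suc n))) * \<gamma> * t (Suc n)"
      by (simp add: t_def sum_distrib_left del: of_nat_Suc)
    finally show ?thesis
      using qp unfolding sum_nbrs_sphere
      by (auto simp: t_def branching_def algebra_simps simp del: of_nat_Suc)
  qed
  define q where "q = complex_of_real (qq qp qm)"
  have "qp > 0" "qm > 0" using qp qm by simp_all
  then obtain c where c: "\<bar>c\<bar> < 1" "Q qp qm \<gamma> = of_real (real qp + real qm + 2 * c * qq qp qm)" "\<gamma> \<noteq> 0"
    using open_cutE[OF cut] by blast
  have q0: "q \<noteq> 0" using \<open>qp > 0\<close> \<open>qm > 0\<close> by (simp add: q_def qq_def)
  have q2: "q\<^sup>2 = of_nat qp * of_nat qm"
    by (simp add: q_def of_real_qq_square power2_eq_square)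
  \<comment> \<open>Dividing by q^n turns the coefficient q^2 of the oldest term into 1 and Q - qp -
    qm into 2c.\<close>
  define h where "h n = t (2 * n) / q ^ n" for n
  have hrec: "h (Suc (Suc n)) = of_real (2 * c) * h (Suc n) - h n" for n
  proof -
    have br: "branching (2 * n) = qp" "branching (Suc (2 * n)) = qm"
      "branching (Suc (Suc (2 * n))) = qp" "branching (Suc (Suc (Suc (2 * n)))) = qm"
      by (simp_all add: branching_def)
    have "t (2 * Suc (Suc n)) = (Q qp qm \<gamma> - of_nat qp - of_nat qm) * t (2 * Suc n) - q\<^sup>2 * t (2 * n)"
      using rec[of "2 * n"] rec[of "Suc (2 * n)"] rec[of "Suc (Suc (2 * n))"]
      unfolding br q2 Q_def
      using alternating_recurrence[of "t (2 * Suc n)" "of_nat qm" \<gamma> "t (Suc (2 * n))" "of_nat qp"]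
      by (simp add: add_ac)
    also have "Q qp qm \<gamma> - of_nat qp - of_nat qm = of_real (2 * c) * q"
      unfolding c(2) by (simp add: q_def)
    finally show ?thesis
      using q0 by (simp add: h_def field_simps power2_eq_square)
  qed
  have "h \<longlonglongrightarrow> 0"
  proof (rule Lim_transform_eventually)
    show "(\<lambda>n. sum f (sphere_at (2 * n)) / of_real (qq qp qm) ^ n) \<longlonglongrightarrow> 0"
      using f(1) by (rule sphere_sums_tendsto_0)
    show "\<forall>\<^sub>F n in sequentially. sum f (sphere_at (2 * n)) / of_real (qq qp qm) ^ n = h n"
      using eventually_gt_at_top[of "0::nat"] by eventually_elim (simp add: h_def t_def q_def)
  qed
  then have h0: "h n = 0" for n
    using elliptic_recurrence_tendsto_0_complex[of h c] hrec c(1) by blast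
  then have "t (2 * n) = 0" for n using h0[of n] q0 by (simp add: h_def)
  \<comment> \<open>Contradiction: the recurrence at 0 and \<gamma> \<noteq> 0 force
    \<open>t 1\<close> to vanish, whereas the equation at the root with f v0 = 0 gives -(qp +
    1).\<close>
  from this[of 0] this[of 1] have t02: "t 0 = 0" "t (Suc (Suc 0)) = 0" by (simp_all add: numeral_2_eq_2)
  then have "t (Suc 0) = 0"
    using rec[of 0] c(3) by (auto simp del: of_nat_Suc)
  moreover have "f v0 = 0" using t02(1) qp by (simp add: t_def sphere_0 del: of_nat_Suc)
  ultimately show False using t1 by (simp del: of_nat_Suc)
qed

end

section \<open>Closed forms\<close>

text \<open>Leaves \<open>qq\<close> as the only square root in the closed forms, so that the
  algebra rests on the single relation q * q = p * m.\<close>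

lemma sqrt_ratio: "qp > 0 \<Longrightarrow> sqrt (real qm / real qp) = real qm / qq qp qm"
  by (cases "qm = 0") (auto simp: qq_def real_sqrt_divide real_sqrt_mult field_simps)

text \<open>With Z = Q - qp - qm one has W = Z^2 - 4 q^2, hence (Z - R)(Z + R) = 4 q^2. Together
  with \<open>B_add_B'\<close> these are the Vieta relations for the characteristic
  equation.\<close>

lemma B_mult_B':
  assumes "(R \<gamma>)\<^sup>2 = W qp qm \<gamma>" "qp > 0" "qm > 0"
  shows "B qp qm R \<gamma> * B' qp qm R \<gamma> = 1"
proof -
  define q where "q = complex_of_real (qq qp qm)"
  have q: "q \<noteq> 0" "q\<^sup>2 = of_nat qp * of_nat qm"
    using qq_pos[OF assms(2,3)] by (simp_all add: q_def of_real_qq_square power2_eq_square)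
  define Z where "Z = Q qp qm \<gamma> - (of_nat qp + of_nat qm)"
  have "(Z - R \<gamma>) * (Z + R \<gamma>) = Z\<^sup>2 - W qp qm \<gamma>"
    unfolding assms(1)[symmetric] by (simp add: power2_eq_square algebra_simps)
  also have "\<dots> = 4 * q\<^sup>2" by (simp add: W_eq Z_def q)
  finally show ?thesis using q(1)
    by (simp add: B_def B'_def power2_eq_square flip: q_def Z_def)
qed

lemma B_add_B':
  assumes "qp > 0" "qm > 0"
  shows "of_real (qq qp qm) * (B qp qm R \<gamma> + B' qp qm R \<gamma>) = Q qp qm \<gamma> - of_nat qp - of_nat qm"
  using assms by (simp add: B_def B'_def qq_def flip: add_divide_distrib)

text \<open>W = (Q - qp - qm)^2 - 4 q^2 vanishes when Q - qp - qm = \<plusminus>2q. The sign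
  \<sigma> treats the edges \<plusminus>b (\<sigma> = 1) and \<plusminus>a (\<sigma> = -1) at
  once.\<close>

lemma R_eq_0:
  assumes R: "(R \<gamma>)\<^sup>2 = W qp qm \<gamma>"
    and Q: "Q qp qm \<gamma> = of_real (real qp + real qm + 2 * \<sigma> * qq qp qm)" and \<sigma>: "\<sigma> * \<sigma> = 1"
  shows "R \<gamma> = 0"
proof -
  have "(R \<gamma>)\<^sup>2 = of_real ((2 * \<sigma> * qq qp qm)\<^sup>2 - 4 * qp * qm)"
    unfolding R W_eq Q by simp
  also have "(2 * \<sigma> * qq qp qm)\<^sup>2 - 4 * qp * qm = (4 * (\<sigma> * \<sigma>)) * (qq qp qm)\<^sup>2 - 4 * qp * qm"
    by (simp add: power2_eq_square)
  also have "\<dots> = 0" unfolding \<sigma> qq_power2 by simp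
  finally show ?thesis by simp
qed

text \<open>If B is its own inverse \<sigma>, then B' = \<sigma> as well and the sum of the roots
  determines Q. Conversely R vanishes there.\<close>

lemma B_eq_sign_iff:
  assumes R: "(R \<gamma>)\<^sup>2 = W qp qm \<gamma>" and pos: "qp > 0" "qm > 0" and \<sigma>: "\<sigma> * \<sigma> = 1"
  shows "B qp qm R \<gamma> = of_real \<sigma> \<longleftrightarrow> Q qp qm \<gamma> = of_real (real qp + real qm + 2 * \<sigma> * qq qp qm)"
proof
  assume B: "B qp qm R \<gamma> = of_real \<sigma>"
  have "of_real \<sigma> * B' qp qm R \<gamma> = 1" using B_mult_B'[where R = R, OF R pos] B by simp
  then have "of_real (\<sigma> * \<sigma>) * B' qp qm R \<gamma> = of_real \<sigma>" by simp
  then have "B' qp qm R \<gamma> = of_real \<sigma>" using \<sigma> by simp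
  then show "Q qp qm \<gamma> = of_real (real qp + real qm + 2 * \<sigma> * qq qp qm)"
    using B_add_B'[OF pos, of R \<gamma>] B by (simp add: algebra_simps)
next
  assume Q: "Q qp qm \<gamma> = of_real (real qp + real qm + 2 * \<sigma> * qq qp qm)"
  have "R \<gamma> = 0" using R Q \<sigma> by (rule R_eq_0)
  then show "B qp qm R \<gamma> = of_real \<sigma>" using pos by (simp add: B_def Q qq_def)
qed

text \<open>If the even levels carry the powers of z = B/q, the eigenvalue equation at level 2n + 1
  makes the odd value z^n (1 + qm z) / ((qm + 1) \<gamma>). So \<open>Fm\<close> is the factor
  leading from an even level to the next odd one.\<close>

lemma one_plus_B_eq_Fm:
  assumes "\<gamma> \<noteq> 0" "qp > 0" "qm > 0"
  shows "1 + of_nat qm * B qp qm R \<gamma> / of_real (qq qp qm) = (of_nat qm + 1) * \<gamma> * Fm qp qm R \<gamma>"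
    and "1 + of_nat qm * B' qp qm R \<gamma> / of_real (qq qp qm) = (of_nat qm + 1) * \<gamma> * Fm' qp qm R \<gamma>"
proof -
  define q where "q = complex_of_real (qq qp qm)"
  have q: "q \<noteq> 0" "q * q = of_nat qp * of_nat qm"
    using qq_pos[OF assms(2,3)] by (simp_all add: q_def of_real_qq_square)
  have m1: "(of_nat qm + 1 :: complex) \<noteq> 0" by (metis of_nat_Suc of_nat_neq_0 add.commute)
  have m0: "of_nat qm * (x / (2 * q)) / q = x / (2 * of_nat qp)" for x :: complex
  proof -
    have "of_nat qm * (x / (2 * q)) / q = of_nat qm * x / (2 * (q * q))" by simp
    then show ?thesis unfolding q(2) using assms by simp
  qed
  have d0: "(of_nat qm + 1) * \<gamma> * (x / (2 * of_nat qp * (of_nat qm + 1) * \<gamma>)) = x / (2 * of_nat qp)" for x :: complex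
    using m1 assms(1) by simp
  show "1 + of_nat qm * B qp qm R \<gamma> / of_real (qq qp qm) = (of_nat qm + 1) * \<gamma> * Fm qp qm R \<gamma>"
    "1 + of_nat qm * B' qp qm R \<gamma> / of_real (qq qp qm) = (of_nat qm + 1) * \<gamma> * Fm' qp qm R \<gamma>"
    unfolding B_def B'_def Fm_def Fm'_def q_def[symmetric] m0 d0 using assms
    by (simp_all add: field_simps)
qed

text \<open>The two initial conditions that determine \<kappa> and \<kappa>': since p + m + q (x +
  y) is Q, the second right-hand side is q times the value at level 2.\<close>

lemma kappa_sum:
  fixes x y q p m :: "'a::field_char_0"
  assumes xy: "x * y = 1" and q: "q * q = p * m" and nz: "x\<^sup>2 \<noteq> 1" "p + 1 \<noteq> 0" "m \<noteq> 0" "q \<noteq> 0"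
  defines "k \<equiv> \<lambda>z. p / ((p + 1) * (z\<^sup>2 - 1)) * (z - 1 / q) * (z + m / q)"
  shows "k x + k y = 1" "k x * x + k y * y = q * (((p + m + q * (x + y)) / (p + 1) - 1) / m)"
proof -
  have x0: "x \<noteq> 0" using xy by auto
  have y: "y = 1 / x" using xy x0 by (simp add: field_simps)
  define d where "d = x\<^sup>2 - 1"
  have d: "d \<noteq> 0" using nz(1) by (simp add: d_def)
  have kx: "k x = p / ((p + 1) * d * (q * q)) * ((q * x - 1) * (q * x + m))"
    unfolding k_def d_def[symmetric] using nz d by (simp add: divide_simps) (simp add: ac_simps)
  \<comment> \<open>Substituting y = 1/x puts both coefficients over the same denominator, with
    opposite signs; the numerators are then subtracted and d cancels.\<close>
  have yy: "y\<^sup>2 - 1 = - d / x\<^sup>2" "y - 1 / q = (q - x) / (x * q)" "y + m / q = (q + m * x) / (x * q)"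
    using x0 nz by (simp_all add: y d_def field_simps)
  have ky: "k y = - p / ((p + 1) * d * (q * q)) * ((q - x) * (q + m * x))"
    unfolding k_def yy using nz(2,4) d x0 by (simp add: divide_simps power2_eq_square)
  have p0: "p \<noteq> 0" using q nz by auto
  have "k x + k y = p / ((p + 1) * d * (q * q)) * ((q * x - 1) * (q * x + m) - (q - x) * (q + m * x))"
    unfolding kx ky by (simp add: right_diff_distrib)
  also have "(q * x - 1) * (q * x + m) - (q - x) * (q + m * x) = d * (q * q + m)"
    by (simp add: d_def algebra_simps power2_eq_square)
  also have "p / ((p + 1) * d * (q * q)) * (d * (q * q + m)) = 1"
    unfolding q using nz d p0 by (simp add: divide_simps) (simp add: algebra_simps)
  finally show "k x + k y = 1" .
  have "k x * x + k y * y = p / ((p + 1) * d * (q * q)) *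
      ((q * x - 1) * (q * x + m) * x - (q - x) * (q + m * x) * y)"
    unfolding kx ky by (simp add: right_diff_distrib mult.assoc)
  also have "(q * x - 1) * (q * x + m) * x - (q - x) * (q + m * x) * y =
      d * q * (q * (x + y) + m - 1)"
    using xy unfolding d_def by algebra
  also have "p / ((p + 1) * d * (q * q)) * (d * q * (q * (x + y) + m - 1)) =
      p / ((p + 1) * q) * (q * (x + y) + m - 1)"
    using nz d by simp
  also have "\<dots> = q * (((p + m + q * (x + y)) / (p + 1) - 1) / m)"
  proof -
    have "p / ((p + 1) * q) = q / ((p + 1) * m)" using q nz by (simp add: divide_simps)
    moreover have "(p + m + q * (x + y)) / (p + 1) - 1 = (q * (x + y) + m - 1) / (p + 1)"
      using nz(2) by (simp add: field_simps)
    ultimately show ?thesis by simp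
  qed
  finally show "k x * x + k y * y = q * (((p + m + q * (x + y)) / (p + 1) - 1) / m)" .
qed

lemma two_step_recurrence_unique:
  fixes x y :: "nat \<Rightarrow> 'a::field"
  assumes "d \<noteq> 0" "x 0 = y 0" "x 1 = y 1"
    and "\<And>n. d * x (Suc (Suc n)) = k * x (Suc n) - x n"
    and "\<And>n. d * y (Suc (Suc n)) = k * y (Suc n) - y n"
  shows "x n = y n"
proof -
  have "x n = y n \<and> x (Suc n) = y (Suc n)"
  proof (induction n)
    case (Suc n)
    then have "d * x (Suc (Suc n)) = d * y (Suc (Suc n))" using assms(4,5) by simp
    then show ?case using Suc assms(1) by simp
  qed (use assms in simp_all)
  then show ?thesis ..
qed

section \<open>Solving the recurrence on the tree, for simple and for double characteristic
  roots\<close>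

context rooted_semihomogeneous_tree
begin

lemma radial_seq_rec:
  "of_nat (branching (Suc n)) * radial_seq \<gamma> (Suc (Suc n)) =
    (of_nat (branching (Suc n)) + 1) * \<gamma> * radial_seq \<gamma> (Suc n) - radial_seq \<gamma> n"
  using branching_pos[of "Suc n"] by (simp add: add.commute)

text \<open>For values, as opposed to sphere sums, the branching numbers multiply the newest term,
  so the elimination of the odd levels leaves their product in front of the newest term.\<close>

lemma radial_seq_even_rec:
  "of_nat qp * of_nat qm * radial_seq \<gamma> (2 * Suc (Suc n)) =
    (Q qp qm \<gamma> - of_nat qp - of_nat qm) * radial_seq \<gamma> (2 * Suc n) - radial_seq \<gamma> (2 * n)"
proof -
  define p m where "p = complex_of_nat qp" and "m = complex_of_nat qm"
  define x0 x1 x2 x3 x4 where "x0 = radial_seq \<gamma> (2 * n)" and "x1 = radial_seq \<gamma> (Suc (2 * n))"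
    and "x2 = radial_seq \<gamma> (Suc (Suc (2 * n)))" and "x3 = radial_seq \<gamma> (Suc (Suc (Suc (2 * n))))"
    and "x4 = radial_seq \<gamma> (Suc (Suc (Suc (Suc (2 * n)))))"
  have br: "branching (Suc (2 * n)) = qm" "branching (Suc (Suc (2 * n))) = qp"
    "branching (Suc (Suc (Suc (2 * n)))) = qm"
    by (simp_all add: branching_def)
  have "m * x2 = (m + 1) * \<gamma> * x1 - x0" "p * x3 = (p + 1) * \<gamma> * x2 - x1"
    "m * x4 = (m + 1) * \<gamma> * x3 - x2"
    using radial_seq_rec[of "2 * n" \<gamma>] radial_seq_rec[of "Suc (2 * n)" \<gamma>]
      radial_seq_rec[of "Suc (Suc (2 * n))" \<gamma>]
    unfolding br p_def m_def x0_def x1_def x2_def x3_def x4_def by blast+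
  then have "p * m * x4 = ((p + 1) * (m + 1) * \<gamma>\<^sup>2 - p - m) * x2 - x0"
    by algebra
  then show ?thesis
    unfolding p_def m_def x0_def x2_def x4_def Q_def by (simp del: radial_seq.simps)
qed

lemma radial_seq_2: "radial_seq \<gamma> 2 = (Q qp qm \<gamma> / (of_nat qp + 1) - 1) / of_nat qm"
proof -
  have p1: "(of_nat qp + 1 :: complex) \<noteq> 0" by (metis of_nat_Suc of_nat_neq_0 add.commute)
  have "of_nat qm * radial_seq \<gamma> 2 = (of_nat qm + 1) * \<gamma> * \<gamma> - 1"
    using radial_seq_rec[of 0 \<gamma>] by (simp add: branching_def numeral_2_eq_2 del: radial_seq.simps(3))
  also have "\<dots> = Q qp qm \<gamma> / (of_nat qp + 1) - 1"
    using p1 by (simp add: Q_def power2_eq_square)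
  finally show ?thesis using qm by (simp add: eq_divide_eq mult.commute)
qed

text \<open>Kept undivided: this determines the odd values only for \<gamma> \<noteq> 0.\<close>

lemma radial_seq_odd:
  "(of_nat qm + 1) * \<gamma> * radial_seq \<gamma> (Suc (2 * n)) =
    radial_seq \<gamma> (2 * n) + of_nat qm * radial_seq \<gamma> (2 * Suc n)"
  using radial_seq_rec[of "2 * n" \<gamma>] by (simp add: branching_def del: radial_seq.simps)

text \<open>At \<gamma> = 0 the recurrence couples only levels of equal parity, and level 1 carries
  \<gamma> itself.\<close>

lemma radial_seq_0_odd: "odd n \<Longrightarrow> radial_seq 0 n = 0"
  by (induction "0::complex" n rule: radial_seq.induct) auto

lemma radial_seq_eqI:
  assumes "x 0 = 1" "x 1 = (Q qp qm \<gamma> / (of_nat qp + 1) - 1) / of_nat qm"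
    and "\<And>n. of_nat qp * of_nat qm * x (Suc (Suc n)) = (Q qp qm \<gamma> - of_nat qp - of_nat qm) * x (Suc n) - x n"
  shows "radial_seq \<gamma> (2 * n) = x n"
  by (rule two_step_recurrence_unique[of "of_nat qp * of_nat qm" _ _ "Q qp qm \<gamma> - of_nat qp - of_nat qm"])
    (use qp qm assms radial_seq_even_rec radial_seq_2 in \<open>simp_all del: radial_seq.simps(3)\<close>)

lemma radial_seq_closed_form:
  assumes R: "(R \<gamma>)\<^sup>2 = W qp qm \<gamma>" and B: "B qp qm R \<gamma> \<noteq> 1" "B qp qm R \<gamma> \<noteq> - 1"
  shows "radial_seq \<gamma> n =
      kappa qp qm R \<gamma> ((- 1) ^ n) * (B qp qm R \<gamma> / of_real (qq qp qm)) ^ (n div 2)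
    + kappa' qp qm R \<gamma> ((- 1) ^ n) * (B' qp qm R \<gamma> / of_real (qq qp qm)) ^ (n div 2)"
proof -
  define x y q p m where "x = B qp qm R \<gamma>" and "y = B' qp qm R \<gamma>"
    and "q = complex_of_real (qq qp qm)" and "p = complex_of_nat qp" and "m = complex_of_nat qm"
  have pos: "qp > 0" "qm > 0" using qp qm by simp_all
  have q: "q * q = p * m" "q \<noteq> 0"
    using qq_pos[OF pos] by (simp_all add: q_def p_def m_def of_real_qq_square)
  have xy: "x * y = 1" unfolding x_def y_def by (rule B_mult_B'[where R = R, OF R pos])
  have sum: "Q qp qm \<gamma> - p - m = q * (x + y)"
    unfolding x_def y_def q_def p_def m_def by (rule B_add_B'[OF pos, symmetric])
  have x1: "x\<^sup>2 \<noteq> 1" using B by (simp add: x_def power2_eq_1_iff)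
  have nz: "p \<noteq> 0" "m \<noteq> 0" "p + 1 \<noteq> 0"
    using pos by (simp_all add: p_def m_def) (metis of_nat_Suc of_nat_neq_0 add.commute)
  define k where "k = (\<lambda>z. p / ((p + 1) * (z\<^sup>2 - 1)) * (z - 1 / q) * (z + m / q))"
  have rt: "complex_of_real (sqrt (real qm / real qp)) = m / q"
    using pos by (simp add: sqrt_ratio m_def q_def)
  have kk: "kappa qp qm R \<gamma> \<epsilon> = k x * (if \<epsilon> = 1 then 1 else Fm qp qm R \<gamma>)"
    "kappa' qp qm R \<gamma> \<epsilon> = k y * (if \<epsilon> = 1 then 1 else Fm' qp qm R \<gamma>)" for \<epsilon>
    unfolding kappa_def kappa'_def k_def rt by (simp_all add: x_def y_def p_def m_def q_def)
  have ks: "k x + k y = 1" "k x * x + k y * y = q * (((p + m + q * (x + y)) / (p + 1) - 1) / m)"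
    unfolding k_def by (rule kappa_sum[OF xy q(1) x1 nz(3,2) q(2)])+
  have even: "radial_seq \<gamma> (2 * n) = k x * (x / q) ^ n + k y * (y / q) ^ n" for n
  proof (rule radial_seq_eqI)
    show "k x * (x / q) ^ 0 + k y * (y / q) ^ 0 = 1" using ks(1) by simp
    have "k x * x + k y * y = q * ((Q qp qm \<gamma> / (p + 1) - 1) / m)"
      unfolding ks(2) sum[symmetric] by simp
    then show "k x * (x / q) ^ 1 + k y * (y / q) ^ 1 = (Q qp qm \<gamma> / (of_nat qp + 1) - 1) / of_nat qm"
      using q(2) unfolding p_def[symmetric] m_def[symmetric]
      by (simp add: nonzero_divide_eq_eq flip: add_divide_distrib)
  next
    fix n
    \<comment> \<open>A multiple of the powers of \<open>u\<close> satisfies the recurrence once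
      \<open>u\<close> is a root of the characteristic equation; \<open>w\<close> stands for the
      n-th power.\<close>
    have step: "d * (c * (u * (u * w))) = e * (c * (u * w)) - c * w" if "d * (u * u) = e * u - 1"
      for c d e u w :: complex
    proof -
      have "d * (c * (u * (u * w))) = c * w * (d * (u * u))" by (simp only: ac_simps)
      then show ?thesis unfolding that by (simp add: algebra_simps)
    qed
    \<comment> \<open>Both sides equal x^2, respectively y^2, because x y = 1.\<close>
    have "q * q * (x / q * (x / q)) = q * (x + y) * (x / q) - 1" "q * q * (y / q * (y / q)) = q * (x + y) * (y / q) - 1"
      using q(2) xy by (simp_all add: algebra_simps)
    then have "q * q * (k x * (x / q) ^ Suc (Suc n) + k y * (y / q) ^ Suc (Suc n)) =
      q * (x + y) * (k x * (x / q) ^ Suc n + k y * (y / q) ^ Suc n) - (k x * (x / q) ^ n + k y * (y / q) ^ n)"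
      by (simp only: power_Suc distrib_left step) (simp add: algebra_simps)
    then show "of_nat qp * of_nat qm * (k x * (x / q) ^ Suc (Suc n) + k y * (y / q) ^ Suc (Suc n)) =
      (Q qp qm \<gamma> - of_nat qp - of_nat qm) * (k x * (x / q) ^ Suc n + k y * (y / q) ^ Suc n)
        - (k x * (x / q) ^ n + k y * (y / q) ^ n)"
      unfolding p_def[symmetric] m_def[symmetric] sum q(1) .
  qed
  have odd: "radial_seq \<gamma> (Suc (2 * n)) =
      k x * Fm qp qm R \<gamma> * (x / q) ^ n + k y * Fm' qp qm R \<gamma> * (y / q) ^ n" for n
  proof (cases "\<gamma> = 0")
    case True
    \<comment> \<open>The junk value \<open>x / 0 = 0\<close> of \<open>Fm\<close> and \<open>Fm'\<close> happens to be the right one here.\<close>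
    then show ?thesis by (simp add: radial_seq_0_odd Fm_def Fm'_def)
  next
    case False
    have m1: "m + 1 \<noteq> 0" unfolding m_def by (metis of_nat_Suc of_nat_neq_0 add.commute)
    have F: "1 + m * (x / q) = (m + 1) * \<gamma> * Fm qp qm R \<gamma>" "1 + m * (y / q) = (m + 1) * \<gamma> * Fm' qp qm R \<gamma>"
      using one_plus_B_eq_Fm[OF False pos] by (simp_all add: m_def x_def y_def q_def)
    have "(m + 1) * \<gamma> * radial_seq \<gamma> (Suc (2 * n)) =
      k x * (x / q) ^ n * (1 + m * (x / q)) + k y * (y / q) ^ n * (1 + m * (y / q))"
      using radial_seq_odd[of \<gamma> n] unfolding even m_def[symmetric] power_Suc by (simp add: algebra_simps)
    also have "\<dots> = (m + 1) * \<gamma> * (k x * Fm qp qm R \<gamma> * (x / q) ^ n + k y * Fm' qp qm R \<gamma> * (y / q) ^ n)"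
      unfolding F by (simp add: algebra_simps)
    finally show ?thesis using m1 False by simp
  qed
  show ?thesis
    unfolding kk x_def[symmetric] y_def[symmetric] q_def[symmetric]
  proof (cases "even n")
    case True
    then obtain j where "n = 2 * j" by blast
    then show "radial_seq \<gamma> n = k x * (if (- 1) ^ n = (1::int) then 1 else Fm qp qm R \<gamma>) * (x / q) ^ (n div 2)
        + k y * (if (- 1) ^ n = (1::int) then 1 else Fm' qp qm R \<gamma>) * (y / q) ^ (n div 2)"
      using even[of j] by simp
  next
    case False
    then obtain j where "n = Suc (2 * j)" by (metis oddE Suc_eq_plus1)
    then show "radial_seq \<gamma> n = k x * (if (- 1) ^ n = (1::int) then 1 else Fm qp qm R \<gamma>) * (x / q) ^ (n div 2)
        + k y * (if (- 1) ^ n = (1::int) then 1 else Fm' qp qm R \<gamma>) * (y / q) ^ (n div 2)"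
      using odd[of j] by simp
  qed
qed

text \<open>The characteristic equation becomes (r z - 1)^2 = 0, so solutions are linear in n times
  r^(-n), and the value at level 2 fixes the slope \<open>c\<close>. The odd levels stay multiplied
  by (qm + 1) \<gamma>; at the edges the factor 1 + qm / r becomes (qm + 1) \<gamma> times
  \<open>Fm\<close>.\<close>

lemma radial_seq_double_root:
  assumes r: "r * r = of_nat qp * of_nat qm" and Q: "Q qp qm \<gamma> = of_nat qp + of_nat qm + 2 * r"
  defines "c \<equiv> of_nat qp / (of_nat qp + 1) * (1 - 1 / r) * (1 + of_nat qm / r)"
  shows "radial_seq \<gamma> (2 * n) = (1 + c * of_nat n) / r ^ n"
    and "(of_nat qm + 1) * \<gamma> * radial_seq \<gamma> (Suc (2 * n)) =
      ((of_nat qp + r) / (of_nat qp + 1) + c * of_nat n) / r ^ n * (1 + of_nat qm / r)"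
proof -
  define p m where "p = complex_of_nat qp" and "m = complex_of_nat qm"
  have nz: "p \<noteq> 0" "m \<noteq> 0" "p + 1 \<noteq> 0"
    using qp qm by (simp_all add: p_def m_def) (metis of_nat_Suc of_nat_neq_0 add.commute)
  have r': "r * r = p * m" using r by (simp add: p_def m_def)
  then have r0: "r \<noteq> 0" using nz by auto
  have c: "c = p / (p + 1) * (1 - 1 / r) * (1 + m / r)" by (simp add: c_def p_def m_def)
  \<comment> \<open>As r * r = p * m, the factor m p / r^2 disappears. This lets 1 + m / r be pulled
    out on the odd levels.\<close>
  have key: "m / r * c = (r - 1) / (p + 1) * (1 + m / r)"
  proof -
    have r1: "1 - 1 / r = (r - 1) / r" using r0 by (simp add: field_simps)
    have "m / r * c = m * p / (r * r) * ((r - 1) / (p + 1) * (1 + m / r))"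
      unfolding c r1 using r0 nz by (simp add: ac_simps)
    then show ?thesis unfolding r' using nz by simp
  qed
  have even: "radial_seq \<gamma> (2 * n) = (1 + c * of_nat n) / r ^ n" for n
  proof (rule radial_seq_eqI)
    have "m * (1 + c) = m + r * (m / r * c)" using r0 by (simp add: algebra_simps)
    also have "\<dots> = m + (r - 1) / (p + 1) * (r + m)" 
    proof -
      have "r * (m / r * c) = (r - 1) / (p + 1) * (r * (1 + m / r))" unfolding key by simp
      also have "r * (1 + m / r) = r + m" using r0 by (simp add: field_simps)
      finally show ?thesis by simp
    qed
    also have "\<dots> = (m * p + m + r * r - r + r * m - m) / (p + 1)"
      using nz by (simp add: divide_simps) (simp add: algebra_simps)
    also have "\<dots> = (r * (m + 2 * r - 1)) / (p + 1)"
      using r' by (simp add: algebra_simps)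
    finally have "m * (1 + c) = r * ((p + m + 2 * r) / (p + 1) - 1)"
      using nz by (simp add: divide_simps)
    then show "(1 + c * of_nat 1) / r ^ 1 = (Q qp qm \<gamma> / (of_nat qp + 1) - 1) / of_nat qm"
      unfolding Q p_def[symmetric] m_def[symmetric] using r0 nz(2) by (simp add: frac_eq_eq mult.commute)
  next
    fix n
    show "of_nat qp * of_nat qm * ((1 + c * of_nat (Suc (Suc n))) / r ^ Suc (Suc n)) =
      (Q qp qm \<gamma> - of_nat qp - of_nat qm) * ((1 + c * of_nat (Suc n)) / r ^ Suc n) - (1 + c * of_nat n) / r ^ n"
      unfolding r[symmetric] Q using r0 by (simp add: divide_simps) (simp add: algebra_simps)
  qed simp
  show "radial_seq \<gamma> (2 * n) = (1 + c * of_nat n) / r ^ n" by (rule even)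
  have "(of_nat qm + 1) * \<gamma> * radial_seq \<gamma> (Suc (2 * n)) =
      (1 + c * of_nat n + m / r * (1 + c * of_nat (Suc n))) / r ^ n"
    unfolding radial_seq_odd unfolding even m_def[symmetric] using r0 by (simp add: field_simps)
  also have "1 + c * of_nat n + m / r * (1 + c * of_nat (Suc n)) =
      1 + m / r + m / r * c + c * of_nat n * (1 + m / r)"
    using r0 by (simp add: field_simps)
  also have "\<dots> = ((p + r) / (p + 1) + c * of_nat n) * (1 + m / r)"
  proof -
    \<comment> \<open>Origin of the constant term for odd levels: the 1 of the even levels plus the
      contribution of \<open>key\<close>.\<close>
    have "(p + r) / (p + 1) = 1 + (r - 1) / (p + 1)" using nz by (simp add: field_simps)
    then show ?thesis unfolding key by (simp only: distrib_right mult_1_left)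
  qed
  finally show "(of_nat qm + 1) * \<gamma> * radial_seq \<gamma> (Suc (2 * n)) =
      ((of_nat qp + r) / (of_nat qp + 1) + c * of_nat n) / r ^ n * (1 + of_nat qm / r)"
    by (simp add: p_def m_def)
qed

end

section \<open>Values at the edges of the cut\<close>

lemma edge_a_nonneg: "edge_a qp qm \<ge> 0"
  by (simp add: edge_a_def)

lemma edge_b_pos: "qp > 0 \<Longrightarrow> edge_b qp qm > 0"
  by (simp add: edge_b_def add_pos_nonneg)

lemma edge_a_pos: "qp \<noteq> qm \<Longrightarrow> edge_a qp qm > 0"
  by (simp add: edge_a_def)

text \<open>Makes R^2 = W available at the edges, including the edge 0 of the homogeneous
  case.\<close>

lemma edge_notin_open_cut:
  assumes "s \<in> {1, - 1 :: real}"
  shows "of_real (s * edge_a qp qm) \<notin> open_cut qp qm" "of_real (s * edge_b qp qm) \<notin> open_cut qp qm"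
proof -
  have "edge_b qp qm \<ge> 0" by (simp add: edge_b_def)
  then show "of_real (s * edge_a qp qm) \<notin> open_cut qp qm" "of_real (s * edge_b qp qm) \<notin> open_cut qp qm"
    using assms edge_a_nonneg[of qp qm] unfolding open_cut_def
    by (auto simp del: of_real_mult of_real_minus simp: image_iff)
qed

text \<open>The unsimplified factors 1 and -1 keep the shape of the instances of
  \<open>B_eq_sign_iff\<close> and \<open>F_at_edge\<close> at \<sigma> = \<plusminus>1.\<close>

lemma Q_edge_iff:
  "Q qp qm \<gamma> = of_real (real qp + real qm + 2 * 1 * qq qp qm) \<longleftrightarrow>
     \<gamma> = of_real (edge_b qp qm) \<or> \<gamma> = - of_real (edge_b qp qm)"
  "Q qp qm \<gamma> = of_real (real qp + real qm + 2 * - 1 * qq qp qm) \<longleftrightarrow>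
     \<gamma> = of_real (edge_a qp qm) \<or> \<gamma> = - of_real (edge_a qp qm)"
proof -
  define D where "D = (real qp + 1) * (real qm + 1)"
  have D: "D > 0" by (simp add: D_def)
  have "Q qp qm \<gamma> = of_real (D * e\<^sup>2) \<longleftrightarrow> \<gamma> = of_real e \<or> \<gamma> = - of_real e" for e
  proof -
    have "Q qp qm \<gamma> = of_real D * \<gamma>\<^sup>2" by (simp add: Q_def D_def)
    then have "Q qp qm \<gamma> = of_real (D * e\<^sup>2) \<longleftrightarrow> \<gamma>\<^sup>2 = (of_real e)\<^sup>2" using D by simp
    then show ?thesis by (simp add: power2_eq_iff)
  qed
  moreover have "D * (edge_b qp qm)\<^sup>2 = real qp + real qm + 2 * 1 * qq qp qm"
    "D * (edge_a qp qm)\<^sup>2 = real qp + real qm + 2 * - 1 * qq qp qm"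
    unfolding D_def edge_squares by (simp_all add: power2_sum power2_diff qq_def real_sqrt_mult)
  ultimately show
    "Q qp qm \<gamma> = of_real (real qp + real qm + 2 * 1 * qq qp qm) \<longleftrightarrow>
       \<gamma> = of_real (edge_b qp qm) \<or> \<gamma> = - of_real (edge_b qp qm)"
    "Q qp qm \<gamma> = of_real (real qp + real qm + 2 * - 1 * qq qp qm) \<longleftrightarrow>
       \<gamma> = of_real (edge_a qp qm) \<or> \<gamma> = - of_real (edge_a qp qm)"
    by metis+
qed

text \<open>As R vanishes, each F agrees with its conjugate, and the numerator Q \<plusminus> (qp -
  qm) is twice qp + \<sigma> q or qm + \<sigma> q.\<close>

lemma F_at_edge:
  assumes R: "(R (of_real x))\<^sup>2 = W qp qm (of_real x)"
    and Q: "Q qp qm (of_real x) = of_real (real qp + real qm + 2 * \<sigma> * qq qp qm)" and \<sigma>: "\<sigma> * \<sigma> = 1"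
  shows "Fm qp qm R (of_real x) = of_real ((real qp + \<sigma> * qq qp qm) / (real qp * (real qm + 1) * x))"
    "Fm' qp qm R (of_real x) = of_real ((real qp + \<sigma> * qq qp qm) / (real qp * (real qm + 1) * x))"
    "Fp qp qm R (of_real x) = of_real ((real qm + \<sigma> * qq qp qm) / (real qm * (real qp + 1) * x))"
    "Fp' qp qm R (of_real x) = of_real ((real qm + \<sigma> * qq qp qm) / (real qm * (real qp + 1) * x))"
proof -
  have R0: "R (of_real x) = 0" using R Q \<sigma> by (rule R_eq_0)
  have half: "2 * a / (2 * b * c * d) = a / (b * c * d)" for a b c d :: complex
    by (simp add: mult.assoc)
  have e: "of_real (real qp + real qm + 2 * \<sigma> * qq qp qm) + (of_nat qp - of_nat qm) =
      2 * complex_of_real (real qp + \<sigma> * qq qp qm)"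
    "of_real (real qp + real qm + 2 * \<sigma> * qq qp qm) - (of_nat qp - of_nat qm) =
      2 * complex_of_real (real qm + \<sigma> * qq qp qm)"
    by simp_all
  show "Fm qp qm R (of_real x) = of_real ((real qp + \<sigma> * qq qp qm) / (real qp * (real qm + 1) * x))"
    "Fm' qp qm R (of_real x) = of_real ((real qp + \<sigma> * qq qp qm) / (real qp * (real qm + 1) * x))"
    "Fp qp qm R (of_real x) = of_real ((real qm + \<sigma> * qq qp qm) / (real qm * (real qp + 1) * x))"
    "Fp' qp qm R (of_real x) = of_real ((real qm + \<sigma> * qq qp qm) / (real qm * (real qp + 1) * x))"
    unfolding Fm_def Fm'_def Fp_def Fp'_def R0 Q diff_0_right add_0_right e half by simp_all
qed

text \<open>With P, M the square roots of qp, qm, the numerator is P (P \<plusminus> M). Its second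
  factor cancels against the numerator of the edge: completely for b, and up to the sign of P - M
  for a, where the edge contains |P - M|.\<close>

lemma edge_ratio:
  assumes p: "qp > 0" "qm > 0" and s: "s \<in> {1, - 1 :: real}"
  shows "(real qp + 1 * qq qp qm) / (real qp * (real qm + 1) * (s * edge_b qp qm)) =
      s * sqrt ((real qp + 1) / (real qp * (real qm + 1)))"
    and "qp \<noteq> qm \<Longrightarrow> (real qp + - 1 * qq qp qm) / (real qp * (real qm + 1) * (s * edge_a qp qm)) =
      s * sqrt ((real qp + 1) / (real qp * (real qm + 1))) * sgn (real qp - real qm)"
proof -
  define P M P1 M1 where "P = sqrt qp" and "M = sqrt qm" and "P1 = sqrt (real qp + 1)" and "M1 = sqrt (real qm + 1)"
  have pos: "P > 0" "M > 0" "P1 > 0" "M1 > 0" using p by (simp_all add: P_def M_def P1_def M1_def)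
  have sq: "real qp = P * P" "real qm + 1 = M1 * M1" "qq qp qm = P * M"
    by (simp_all add: P_def M_def M1_def qq_def real_sqrt_mult)
  have rt: "sqrt ((real qp + 1) / (real qp * (real qm + 1))) = P1 / (P * M1)"
    "edge_b qp qm = (P + M) / (P1 * M1)" "edge_a qp qm = \<bar>P - M\<bar> / (P1 * M1)"
    by (simp_all add: edge_a_def edge_b_def real_sqrt_divide real_sqrt_mult P_def M_def P1_def M1_def)
  have s': "s * s = 1" "s \<noteq> 0" using s by auto
  have inv: "1 / s = s" using s by auto
  have calc: "P * x / (P * P * (M1 * M1) * (s * (y / (P1 * M1)))) = s * (P1 / (P * M1)) * (x / y)" for x y
  proof -
    have "P * x / (P * P * (M1 * M1) * (s * (y / (P1 * M1)))) = (1 / s) * (P1 / (P * M1)) * (x / y)"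
      using pos s' by (cases "y = 0") (simp_all add: field_simps)
    then show ?thesis unfolding inv .
  qed
  have "(real qp + 1 * qq qp qm) / (real qp * (real qm + 1) * (s * edge_b qp qm)) =
      P * (P + M) / (P * P * (M1 * M1) * (s * ((P + M) / (P1 * M1))))"
    unfolding sq rt by (simp add: algebra_simps)
  also have "\<dots> = s * sqrt ((real qp + 1) / (real qp * (real qm + 1)))"
    unfolding calc rt using pos by simp
  finally show "(real qp + 1 * qq qp qm) / (real qp * (real qm + 1) * (s * edge_b qp qm)) =
      s * sqrt ((real qp + 1) / (real qp * (real qm + 1)))" .
  show "(real qp + - 1 * qq qp qm) / (real qp * (real qm + 1) * (s * edge_a qp qm)) =
      s * sqrt ((real qp + 1) / (real qp * (real qm + 1))) * sgn (real qp - real qm)" if "qp \<noteq> qm"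
  proof -
  have sg: "(P - M) / \<bar>P - M\<bar> = sgn (real qp - real qm)"
    by (simp add: P_def M_def sgn_if flip: real_sgn_eq)
  have "(real qp + - 1 * qq qp qm) / (real qp * (real qm + 1) * (s * edge_a qp qm)) =
      P * (P - M) / (P * P * (M1 * M1) * (s * (\<bar>P - M\<bar> / (P1 * M1))))"
    unfolding sq rt by (simp add: algebra_simps)
  also have "\<dots> = s * sqrt ((real qp + 1) / (real qp * (real qm + 1))) * sgn (real qp - real qm)"
    unfolding calc rt sg ..
  finally show ?thesis .
  qed
qed

text \<open>Gives the values of \<open>Fp\<close> from \<open>edge_ratio\<close> with qp and qm
  exchanged.\<close>

lemma edge_commute: "qq qm qp = qq qp qm" "edge_a qm qp = edge_a qp qm" "edge_b qm qp = edge_b qp qm"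
  by (simp_all add: qq_def edge_a_def edge_b_def mult.commute add.commute abs_minus_commute)

section \<open>The spherical function outside the spectrum and at the edges\<close>

context rooted_semihomogeneous_tree
begin

lemma spherical_closed_form:
  assumes R: "sqrt_W qp qm R" and \<gamma>: "\<gamma> \<notin> l2_spectrum (mu1 adj)"
    and B: "B qp qm R \<gamma> \<noteq> 1" "B qp qm R \<gamma> \<noteq> - 1"
  shows "spherical adj v0 \<gamma> v =
      kappa qp qm R \<gamma> ((- 1) ^ level v) * (B qp qm R \<gamma> / of_real (qq qp qm)) ^ (level v div 2)
    + kappa' qp qm R \<gamma> ((- 1) ^ level v) * (B' qp qm R \<gamma> / of_real (qq qp qm)) ^ (level v div 2)"
proof -
  have "(R \<gamma>)\<^sup>2 = W qp qm \<gamma>"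
    using R \<gamma> open_cut_subset_spectrum unfolding sqrt_W_def by blast
  then show ?thesis unfolding spherical_eq using B by (rule radial_seq_closed_form)
qed

text \<open>One computation for all four edges, with r = \<sigma> q. The even levels see \<gamma>
  only through Q; the sign of \<gamma> enters through \<open>Fm\<close>.\<close>

lemma spherical_at_edge:
  assumes R: "(R \<gamma>)\<^sup>2 = W qp qm \<gamma>" and \<sigma>: "\<sigma> \<in> {1, - 1}"
    and Q: "Q qp qm \<gamma> = of_real (real qp + real qm + 2 * \<sigma> * qq qp qm)"
  defines "q \<equiv> qq qp qm" and "ratio \<equiv> sqrt (real qm / real qp)"
  shows "even (level v) \<Longrightarrow> spherical adj v0 \<gamma> v =
      of_real ((\<sigma> * q) powi (- int (level v div 2))
        * (1 + real qp / (real qp + 1) * (\<sigma> - 1 / q) * (\<sigma> + ratio) * (real (level v) / 2)))"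
    and "odd (level v) \<Longrightarrow> \<gamma> \<noteq> 0 \<Longrightarrow> spherical adj v0 \<gamma> v =
      of_real ((\<sigma> * q) powi (- int ((level v - 1) div 2))
        * ((real qp + \<sigma> * q) / (real qp + 1)
          + real qp / (real qp + 1) * (\<sigma> - 1 / q) * (\<sigma> + ratio) * ((real (level v) - 1) / 2)))
        * Fm qp qm R \<gamma>"
proof -
  have pos: "qp > 0" "qm > 0" using qp qm by simp_all
  have \<sigma>2: "\<sigma> * \<sigma> = 1" using \<sigma> by auto
  define r where "r = \<sigma> * q"
  define c where "c = real qp / (real qp + 1) * (\<sigma> - 1 / q) * (\<sigma> + ratio)"
  have q: "q > 0" "q * q = real qp * real qm"
    using qq_pos[OF pos] qq_power2[of qp qm] by (simp_all add: q_def power2_eq_square)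
  have r: "complex_of_real r * of_real r = of_nat qp * of_nat qm"
  proof -
    have "r * r = (\<sigma> * \<sigma>) * (q * q)" by (simp add: r_def)
    then show ?thesis unfolding \<sigma>2 q(2) by (metis mult_1 of_real_mult of_real_of_nat_eq)
  qed
  have Qr: "Q qp qm \<gamma> = of_nat qp + of_nat qm + 2 * of_real r" by (simp add: Q r_def q_def)
  \<comment> \<open>Pull \<sigma> out of each factor on the left and use \<sigma>^2 = 1.\<close>
  have "(1 - 1 / r) * (1 + real qm / r) = (\<sigma> - 1 / q) * (\<sigma> + ratio)"
    using \<sigma> by (auto simp: r_def ratio_def sqrt_ratio[OF pos(1)] q_def algebra_simps)
  then have "c = real qp / (real qp + 1) * (1 - 1 / r) * (1 + real qm / r)"
    by (simp add: c_def mult.assoc)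
  then have c: "of_nat qp / (of_nat qp + 1) * (1 - 1 / complex_of_real r) * (1 + of_nat qm / of_real r) = of_real c"
    by simp
  note seq = radial_seq_double_root[OF r Qr, unfolded c]
  have powi: "r powi (- int n) * x = x / r ^ n" for n x
    by (simp add: power_int_minus divide_inverse mult.commute)
  show "spherical adj v0 \<gamma> v =
      of_real ((\<sigma> * q) powi (- int (level v div 2))
        * (1 + real qp / (real qp + 1) * (\<sigma> - 1 / q) * (\<sigma> + ratio) * (real (level v) / 2)))"
    if "even (level v)"
  proof -
    obtain n where n: "level v = 2 * n" using \<open>even (level v)\<close> by blast
    then show ?thesis
      unfolding spherical_eq n seq c_def[symmetric] r_def[symmetric] powi by simp
  qed
  show "spherical adj v0 \<gamma> v =
      of_real ((\<sigma> * q) powi (- int ((level v - 1) div 2))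
        * ((real qp + \<sigma> * q) / (real qp + 1)
          + real qp / (real qp + 1) * (\<sigma> - 1 / q) * (\<sigma> + ratio) * ((real (level v) - 1) / 2)))
        * Fm qp qm R \<gamma>"
    if "odd (level v)" "\<gamma> \<noteq> 0"
  proof -
    obtain n where n: "level v = Suc (2 * n)" using \<open>odd (level v)\<close> by (metis oddE Suc_eq_plus1)
    have m1: "(of_nat qm + 1 :: complex) \<noteq> 0" by (metis of_nat_Suc of_nat_neq_0 add.commute)
    have "B qp qm R \<gamma> = of_real \<sigma>" using B_eq_sign_iff[where R = R, OF R pos \<sigma>2] Q by blast
    moreover have "complex_of_nat qm * of_real \<sigma> / of_real q = of_nat qm / of_real r"
      using \<sigma> by (auto simp: r_def)
    ultimately have "1 + of_nat qm / of_real r = (of_nat qm + 1) * \<gamma> * Fm qp qm R \<gamma>"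
      using one_plus_B_eq_Fm(1)[where R = R, OF that(2) pos] by (simp add: q_def)
    then have "(of_nat qm + 1) * \<gamma> * radial_seq \<gamma> (Suc (2 * n)) = (of_nat qm + 1) * \<gamma> *
        (((of_nat qp + of_real r) / (of_nat qp + 1) + of_real c * of_nat n) / of_real r ^ n * Fm qp qm R \<gamma>)"
      unfolding seq by (simp only: ac_simps)
    then have "radial_seq \<gamma> (Suc (2 * n)) =
        ((of_nat qp + of_real r) / (of_nat qp + 1) + of_real c * of_nat n) / of_real r ^ n * Fm qp qm R \<gamma>"
      using m1 that(2) by (simp only: mult_cancel_left mult_eq_0_iff simp_thms)
    then show ?thesis
      unfolding spherical_eq n c_def[symmetric] r_def[symmetric] powi by simp
  qed
qed

end

theorem theorem7p1:
  fixes qp qm :: nat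
    and Vp Vm :: "'v set"
    and adj :: "'v \<Rightarrow> 'v \<Rightarrow> bool"
    and v0 :: 'v
    and R :: "complex \<Rightarrow> complex"
  assumes "2 \<le> qp" and "2 \<le> qm"
    and "semihomogeneous_tree qp qm Vp Vm adj"
    and "v0 \<in> Vp"
    and "sqrt_W qp qm R"
  defines "len \<equiv> \<lambda>v. graph_dist adj v v0"
    and "\<phi> \<equiv> \<lambda>\<gamma> v. spherical adj v0 \<gamma> v"
    and "q \<equiv> qq qp qm"
    and "a \<equiv> edge_a qp qm"
    and "b \<equiv> edge_b qp qm"
    and "ratio \<equiv> sqrt (real qm / real qp)"
  shows
    "(\<forall>\<gamma>. \<gamma> \<notin> l2_spectrum (mu1 adj) \<longrightarrow> B qp qm R \<gamma> \<noteq> 1 \<longrightarrow> B qp qm R \<gamma> \<noteq> - 1 \<longrightarrow>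
        (\<forall>v. \<phi> \<gamma> v =
           kappa qp qm R \<gamma> ((- 1) ^ len v) * (B qp qm R \<gamma> / of_real q) ^ (len v div 2)
         + kappa' qp qm R \<gamma> ((- 1) ^ len v) * (B' qp qm R \<gamma> / of_real q) ^ (len v div 2)) \<and>
        (\<exists>(c :: int \<Rightarrow> complex) (c' :: int \<Rightarrow> complex). \<forall>v.
           of_real (q powr (real (len v) / 2)) * \<phi> \<gamma> v =
             c ((- 1) ^ len v) * B qp qm R \<gamma> ^ (len v div 2)
           + c' ((- 1) ^ len v) * B' qp qm R \<gamma> ^ (len v div 2)))
   \<and> (\<forall>\<gamma>. \<gamma> \<notin> open_cut qp qm \<longrightarrow>
        (B qp qm R \<gamma> = 1 \<longleftrightarrow> \<gamma> = of_real b \<or> \<gamma> = - of_real b))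
   \<and> (\<forall>s \<in> {1, - 1 :: real}.
        (\<forall>v. even (len v) \<longrightarrow>
           \<phi> (of_real (s * b)) v =
             of_real (q powi (- int (len v div 2))
               * (1 + real qp / (real qp + 1) * (1 - 1 / q) * (1 + ratio) * (real (len v) / 2)))) \<and>
        (\<forall>v. odd (len v) \<longrightarrow>
           \<phi> (of_real (s * b)) v =
             of_real (q powi (- int ((len v - 1) div 2))
               * ((real qp + q) / (real qp + 1)
                  + real qp / (real qp + 1) * (1 - 1 / q) * (1 + ratio) * ((real (len v) - 1) / 2)))
             * Fm qp qm R (of_real (s * b))) \<and>
        Fm qp qm R (of_real (s * b)) = of_real (s * sqrt ((real qp + 1) / (real qp * (real qm + 1)))) \<and>
        Fm' qp qm R (of_real (s * b)) = of_real (s * sqrt ((real qp + 1) / (real qp * (real qm + 1)))) \<and>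
        Fp qp qm R (of_real (s * b)) = of_real (s * sqrt ((real qm + 1) / (real qm * (real qp + 1)))) \<and>
        Fp' qp qm R (of_real (s * b)) = of_real (s * sqrt ((real qm + 1) / (real qm * (real qp + 1)))))
   \<and> (\<forall>\<gamma>. \<gamma> \<notin> open_cut qp qm \<longrightarrow>
        (B qp qm R \<gamma> = - 1 \<longleftrightarrow> \<gamma> = of_real a \<or> \<gamma> = - of_real a))
   \<and> (\<forall>s \<in> {1, - 1 :: real}.
        (\<forall>v. even (len v) \<longrightarrow>
           \<phi> (of_real (s * a)) v =
             of_real ((- q) powi (- int (len v div 2))
               * (1 + real qp / (real qp + 1) * (- 1 - 1 / q) * (- 1 + ratio) * (real (len v) / 2)))) \<and>
        (qp \<noteq> qm \<longrightarrow>
           (\<forall>v. odd (len v) \<longrightarrow>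
              \<phi> (of_real (s * a)) v =
                of_real ((- q) powi (- int ((len v - 1) div 2))
                  * ((real qp - q) / (real qp + 1)
                     + real qp / (real qp + 1) * (- 1 - 1 / q) * (- 1 + ratio) * ((real (len v) - 1) / 2)))
                * Fm qp qm R (of_real (s * a))) \<and>
           Fm qp qm R (of_real (s * a)) =
             of_real (s * sqrt ((real qp + 1) / (real qp * (real qm + 1))) * sgn (real qp - real qm)) \<and>
           Fm' qp qm R (of_real (s * a)) =
             of_real (s * sqrt ((real qp + 1) / (real qp * (real qm + 1))) * sgn (real qp - real qm)) \<and>
           Fp qp qm R (of_real (s * a)) =
             of_real (- s * sqrt ((real qm + 1) / (real qm * (real qp + 1))) * sgn (real qp - real qm)) \<and>
           Fp' qp qm R (of_real (s * a)) =
             of_real (- s * sqrt ((real qm + 1) / (real qm * (real qp + 1))) * sgn (real qp - real qm))) \<and>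
        (qp = qm \<longrightarrow>
           (\<forall>v. odd (len v) \<longrightarrow>
              (- q) powi (- int ((len v - 1) div 2))
                * ((real qp - q) / (real qp + 1)
                   + real qp / (real qp + 1) * (- 1 - 1 / q) * (- 1 + ratio) * ((real (len v) - 1) / 2)) = 0 \<and>
              \<phi> (of_real (s * a)) v = 0)))"
proof -
  interpret rooted_semihomogeneous_tree qp qm Vp Vm adj v0
    using assms(1-4) by unfold_locales
  have pos: "qp > 0" "qm > 0" using assms(1,2) by simp_all
  have q: "q > 0" unfolding q_def by (rule qq_pos[OF pos])
  have RW: "(R \<gamma>)\<^sup>2 = W qp qm \<gamma>" if "\<gamma> \<notin> open_cut qp qm" for \<gamma>
    using assms(5) that unfolding sqrt_W_def by blast
  have Rb: "(R (of_real (s * b)))\<^sup>2 = W qp qm (of_real (s * b))"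
    and Ra: "(R (of_real (s * a)))\<^sup>2 = W qp qm (of_real (s * a))"
    and Qb: "Q qp qm (of_real (s * b)) = of_real (real qp + real qm + 2 * 1 * q)"
    and Qa: "Q qp qm (of_real (s * a)) = of_real (real qp + real qm + 2 * - 1 * q)"
    if "s \<in> {1, - 1}" for s
    using that edge_notin_open_cut[OF that, of qp qm] unfolding a_def b_def q_def Q_edge_iff
    by (auto intro!: RW simp del: of_real_mult)
  have "b > 0" unfolding b_def by (rule edge_b_pos[OF pos(1)])
  have sgns: "(1::real) * 1 = 1" "(- 1::real) * - 1 = 1" "(1::real) \<in> {1, - 1}" "(- 1::real) \<in> {1, - 1}"
    by simp_all
  note Fb = F_at_edge[where R = R, OF Rb Qb[unfolded q_def] sgns(1)]
    and Fa = F_at_edge[where R = R, OF Ra Qa[unfolded q_def] sgns(2)]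
    and sb = spherical_at_edge[where R = R, OF Rb sgns(3) Qb[unfolded q_def]]
    and sa = spherical_at_edge[where R = R, OF Ra sgns(4) Qa[unfolded q_def]]
  show ?thesis
  proof (intro conjI)
    show "\<forall>\<gamma>. \<gamma> \<notin> l2_spectrum (mu1 adj) \<longrightarrow> B qp qm R \<gamma> \<noteq> 1 \<longrightarrow> B qp qm R \<gamma> \<noteq> - 1 \<longrightarrow>
        (\<forall>v. \<phi> \<gamma> v =
           kappa qp qm R \<gamma> ((- 1) ^ len v) * (B qp qm R \<gamma> / of_real q) ^ (len v div 2)
         + kappa' qp qm R \<gamma> ((- 1) ^ len v) * (B' qp qm R \<gamma> / of_real q) ^ (len v div 2)) \<and>
        (\<exists>(c :: int \<Rightarrow> complex) (c' :: int \<Rightarrow> complex). \<forall>v.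
           of_real (q powr (real (len v) / 2)) * \<phi> \<gamma> v =
             c ((- 1) ^ len v) * B qp qm R \<gamma> ^ (len v div 2)
           + c' ((- 1) ^ len v) * B' qp qm R \<gamma> ^ (len v div 2))"
    proof (intro allI impI)
      fix \<gamma> assume "\<gamma> \<notin> l2_spectrum (mu1 adj)" "B qp qm R \<gamma> \<noteq> 1" "B qp qm R \<gamma> \<noteq> - 1"
      then have *: "\<phi> \<gamma> v =
           kappa qp qm R \<gamma> ((- 1) ^ len v) * (B qp qm R \<gamma> / of_real q) ^ (len v div 2)
         + kappa' qp qm R \<gamma> ((- 1) ^ len v) * (B' qp qm R \<gamma> / of_real q) ^ (len v div 2)" for v
        unfolding \<phi>_def len_def q_def by (rule spherical_closed_form[OF assms(5)])
      \<comment> \<open>The discrepancy between the exponents n / 2 and \<open>n div 2\<close>: a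
        factor sqrt q on odd levels, absorbed into the coefficients.\<close>
      define w :: "int \<Rightarrow> complex" where "w \<epsilon> = (if \<epsilon> = 1 then 1 else of_real (sqrt q))" for \<epsilon>
      have w: "of_real (q powr (real n / 2)) = w ((- 1) ^ n) * of_real q ^ (n div 2)" for n
      proof -
        have "q powr (real n / 2) = q ^ (n div 2) * (if even n then 1 else sqrt q)"
        proof (cases "even n")
          case True
          then obtain j where "n = 2 * j" by blast
          then show ?thesis using q by (simp add: powr_realpow)
        next
          case False
          then obtain j where n: "n = Suc (2 * j)" by (metis oddE Suc_eq_plus1)
          have "real n / 2 = real j + 1 / 2" by (simp add: n field_simps)
          then have "q powr (real n / 2) = q powr real j * q powr (1 / 2)" by (simp only: powr_add)
          then show ?thesis using q n by (simp add: powr_realpow powr_half_sqrt)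
        qed
        then show ?thesis by (simp add: w_def)
      qed
      define c c' where "c \<epsilon> = w \<epsilon> * kappa qp qm R \<gamma> \<epsilon>" and "c' \<epsilon> = w \<epsilon> * kappa' qp qm R \<gamma> \<epsilon>" for \<epsilon>
      have "\<forall>v. of_real (q powr (real (len v) / 2)) * \<phi> \<gamma> v =
             c ((- 1) ^ len v) * B qp qm R \<gamma> ^ (len v div 2)
           + c' ((- 1) ^ len v) * B' qp qm R \<gamma> ^ (len v div 2)"
        unfolding w * c_def c'_def using q by (simp add: power_divide distrib_left)
      with * show "(\<forall>v. \<phi> \<gamma> v =
           kappa qp qm R \<gamma> ((- 1) ^ len v) * (B qp qm R \<gamma> / of_real q) ^ (len v div 2)
         + kappa' qp qm R \<gamma> ((- 1) ^ len v) * (B' qp qm R \<gamma> / of_real q) ^ (len v div 2)) \<and>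
        (\<exists>(c :: int \<Rightarrow> complex) (c' :: int \<Rightarrow> complex). \<forall>v.
           of_real (q powr (real (len v) / 2)) * \<phi> \<gamma> v =
             c ((- 1) ^ len v) * B qp qm R \<gamma> ^ (len v div 2)
           + c' ((- 1) ^ len v) * B' qp qm R \<gamma> ^ (len v div 2))"
        by blast
    qed
    show "\<forall>\<gamma>. \<gamma> \<notin> open_cut qp qm \<longrightarrow>
        (B qp qm R \<gamma> = 1 \<longleftrightarrow> \<gamma> = of_real b \<or> \<gamma> = - of_real b)"
      using B_eq_sign_iff[where R = R and \<sigma> = 1, OF RW pos] unfolding Q_edge_iff b_def by simp
    show "\<forall>\<gamma>. \<gamma> \<notin> open_cut qp qm \<longrightarrow>
        (B qp qm R \<gamma> = - 1 \<longleftrightarrow> \<gamma> = of_real a \<or> \<gamma> = - of_real a)"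
      using B_eq_sign_iff[where R = R and \<sigma> = "- 1", OF RW pos] unfolding Q_edge_iff a_def by simp
  next
    show "\<forall>s \<in> {1, - 1 :: real}.
        (\<forall>v. even (len v) \<longrightarrow>
           \<phi> (of_real (s * b)) v =
             of_real (q powi (- int (len v div 2))
               * (1 + real qp / (real qp + 1) * (1 - 1 / q) * (1 + ratio) * (real (len v) / 2)))) \<and>
        (\<forall>v. odd (len v) \<longrightarrow>
           \<phi> (of_real (s * b)) v =
             of_real (q powi (- int ((len v - 1) div 2))
               * ((real qp + q) / (real qp + 1)
                  + real qp / (real qp + 1) * (1 - 1 / q) * (1 + ratio) * ((real (len v) - 1) / 2)))
             * Fm qp qm R (of_real (s * b))) \<and>
        Fm qp qm R (of_real (s * b)) = of_real (s * sqrt ((real qp + 1) / (real qp * (real qm + 1)))) \<and>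
        Fm' qp qm R (of_real (s * b)) = of_real (s * sqrt ((real qp + 1) / (real qp * (real qm + 1)))) \<and>
        Fp qp qm R (of_real (s * b)) = of_real (s * sqrt ((real qm + 1) / (real qm * (real qp + 1)))) \<and>
        Fp' qp qm R (of_real (s * b)) = of_real (s * sqrt ((real qm + 1) / (real qm * (real qp + 1))))"
    proof (intro ballI conjI allI impI)
      fix s v assume s: "s \<in> {1, - 1 :: real}"
      have s0: "complex_of_real (s * b) \<noteq> 0" using s \<open>b > 0\<close> by auto
      show "\<phi> (of_real (s * b)) v =
             of_real (q powi (- int (len v div 2))
               * (1 + real qp / (real qp + 1) * (1 - 1 / q) * (1 + ratio) * (real (len v) / 2)))"
        if "even (len v)"
        using sb(1)[OF s s, of v] that unfolding \<phi>_def len_def q_def ratio_def by simp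
      show "\<phi> (of_real (s * b)) v =
             of_real (q powi (- int ((len v - 1) div 2))
               * ((real qp + q) / (real qp + 1)
                  + real qp / (real qp + 1) * (1 - 1 / q) * (1 + ratio) * ((real (len v) - 1) / 2)))
             * Fm qp qm R (of_real (s * b))"
        if "odd (len v)"
        using sb(2)[OF s s, of v] that s0 unfolding \<phi>_def len_def q_def ratio_def by simp
      note e = edge_ratio(1)[OF pos s, folded b_def]
        and e' = edge_ratio(1)[OF pos(2,1) s, unfolded edge_commute[of qm qp], folded b_def]
      show "Fm qp qm R (of_real (s * b)) = of_real (s * sqrt ((real qp + 1) / (real qp * (real qm + 1))))"
        "Fm' qp qm R (of_real (s * b)) = of_real (s * sqrt ((real qp + 1) / (real qp * (real qm + 1))))"
        "Fp qp qm R (of_real (s * b)) = of_real (s * sqrt ((real qm + 1) / (real qm * (real qp + 1))))"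
        "Fp' qp qm R (of_real (s * b)) = of_real (s * sqrt ((real qm + 1) / (real qm * (real qp + 1))))"
        using Fb[OF s s] unfolding e e' by blast+
    qed
  next
    show "\<forall>s \<in> {1, - 1 :: real}.
        (\<forall>v. even (len v) \<longrightarrow>
           \<phi> (of_real (s * a)) v =
             of_real ((- q) powi (- int (len v div 2))
               * (1 + real qp / (real qp + 1) * (- 1 - 1 / q) * (- 1 + ratio) * (real (len v) / 2)))) \<and>
        (qp \<noteq> qm \<longrightarrow>
           (\<forall>v. odd (len v) \<longrightarrow>
              \<phi> (of_real (s * a)) v =
                of_real ((- q) powi (- int ((len v - 1) div 2))
                  * ((real qp - q) / (real qp + 1)
                     + real qp / (real qp + 1) * (- 1 - 1 / q) * (- 1 + ratio) * ((real (len v) - 1) / 2)))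
                * Fm qp qm R (of_real (s * a))) \<and>
           Fm qp qm R (of_real (s * a)) =
             of_real (s * sqrt ((real qp + 1) / (real qp * (real qm + 1))) * sgn (real qp - real qm)) \<and>
           Fm' qp qm R (of_real (s * a)) =
             of_real (s * sqrt ((real qp + 1) / (real qp * (real qm + 1))) * sgn (real qp - real qm)) \<and>
           Fp qp qm R (of_real (s * a)) =
             of_real (- s * sqrt ((real qm + 1) / (real qm * (real qp + 1))) * sgn (real qp - real qm)) \<and>
           Fp' qp qm R (of_real (s * a)) =
             of_real (- s * sqrt ((real qm + 1) / (real qm * (real qp + 1))) * sgn (real qp - real qm))) \<and>
        (qp = qm \<longrightarrow>
           (\<forall>v. odd (len v) \<longrightarrow>
              (- q) powi (- int ((len v - 1) div 2))
                * ((real qp - q) / (real qp + 1)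
                   + real qp / (real qp + 1) * (- 1 - 1 / q) * (- 1 + ratio) * ((real (len v) - 1) / 2)) = 0 \<and>
              \<phi> (of_real (s * a)) v = 0))"
    proof (rule ballI)
      fix s assume s: "s \<in> {1, - 1 :: real}"
      have even: "\<phi> (of_real (s * a)) v =
             of_real ((- q) powi (- int (len v div 2))
               * (1 + real qp / (real qp + 1) * (- 1 - 1 / q) * (- 1 + ratio) * (real (len v) / 2)))"
        if "even (len v)" for v
        using sa(1)[OF s s, of v] that unfolding \<phi>_def len_def q_def ratio_def by simp
      have odd: "\<phi> (of_real (s * a)) v =
                of_real ((- q) powi (- int ((len v - 1) div 2))
                  * ((real qp - q) / (real qp + 1)
                     + real qp / (real qp + 1) * (- 1 - 1 / q) * (- 1 + ratio) * ((real (len v) - 1) / 2)))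
                * Fm qp qm R (of_real (s * a))"
        if "odd (len v)" "qp \<noteq> qm" for v
      proof -
        have "complex_of_real (s * a) \<noteq> 0" using s edge_a_pos[OF that(2)] by (auto simp: a_def)
        then show ?thesis
          using sa(2)[OF s s, of v] that unfolding \<phi>_def len_def q_def ratio_def by simp
      qed
      have zero: "(- q) powi (- int ((len v - 1) div 2))
                * ((real qp - q) / (real qp + 1)
                   + real qp / (real qp + 1) * (- 1 - 1 / q) * (- 1 + ratio) * ((real (len v) - 1) / 2)) = 0 \<and>
              \<phi> (of_real (s * a)) v = 0"
        if "odd (len v)" "qp = qm" for v
      proof -
        \<comment> \<open>Both terms of the bracket vanish, through qp - q and through -1 + ratio,
          while the function vanishes on odd levels because the eigenvalue is 0.\<close>
        have "a = 0" "q = qp" "ratio = 1" using that(2) pos by (simp_all add: a_def q_def ratio_def edge_a_def qq_def)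
        then show ?thesis
          using that radial_seq_0_odd unfolding \<phi>_def len_def spherical_eq by simp
      qed
      have F: "Fm qp qm R (of_real (s * a)) =
             of_real (s * sqrt ((real qp + 1) / (real qp * (real qm + 1))) * sgn (real qp - real qm))"
           "Fm' qp qm R (of_real (s * a)) =
             of_real (s * sqrt ((real qp + 1) / (real qp * (real qm + 1))) * sgn (real qp - real qm))"
           "Fp qp qm R (of_real (s * a)) =
             of_real (- s * sqrt ((real qm + 1) / (real qm * (real qp + 1))) * sgn (real qp - real qm))"
           "Fp' qp qm R (of_real (s * a)) =
             of_real (- s * sqrt ((real qm + 1) / (real qm * (real qp + 1))) * sgn (real qp - real qm))"
        if "qp \<noteq> qm"
      proof -
        \<comment> \<open>Exchanging qp and qm reverses this sign; hence the opposite signs of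
          \<open>Fm\<close> and \<open>Fp\<close> at \<plusminus>a.\<close>
        have sg: "sgn (real qm - real qp) = - sgn (real qp - real qm)"
          by (simp add: sgn_if)
        note e = edge_ratio(2)[OF pos s that, folded a_def]
          and e' = edge_ratio(2)[OF pos(2,1) s that[symmetric], unfolded edge_commute[of qm qp] sg, folded a_def]
        have m: "- s * x * y = s * x * - y" for x y by simp
        show "Fm qp qm R (of_real (s * a)) =
             of_real (s * sqrt ((real qp + 1) / (real qp * (real qm + 1))) * sgn (real qp - real qm))"
           "Fm' qp qm R (of_real (s * a)) =
             of_real (s * sqrt ((real qp + 1) / (real qp * (real qm + 1))) * sgn (real qp - real qm))"
           "Fp qp qm R (of_real (s * a)) =
             of_real (- s * sqrt ((real qm + 1) / (real qm * (real qp + 1))) * sgn (real qp - real qm))"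
           "Fp' qp qm R (of_real (s * a)) =
             of_real (- s * sqrt ((real qm + 1) / (real qm * (real qp + 1))) * sgn (real qp - real qm))"
          using Fa[OF s s] unfolding e e' m by blast+
      qed
      show "(\<forall>v. even (len v) \<longrightarrow>
           \<phi> (of_real (s * a)) v =
             of_real ((- q) powi (- int (len v div 2))
               * (1 + real qp / (real qp + 1) * (- 1 - 1 / q) * (- 1 + ratio) * (real (len v) / 2)))) \<and>
        (qp \<noteq> qm \<longrightarrow>
           (\<forall>v. odd (len v) \<longrightarrow>
              \<phi> (of_real (s * a)) v =
                of_real ((- q) powi (- int ((len v - 1) div 2))
                  * ((real qp - q) / (real qp + 1)
                     + real qp / (real qp + 1) * (- 1 - 1 / q) * (- 1 + ratio) * ((real (len v) - 1) / 2)))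
                * Fm qp qm R (of_real (s * a))) \<and>
           Fm qp qm R (of_real (s * a)) =
             of_real (s * sqrt ((real qp + 1) / (real qp * (real qm + 1))) * sgn (real qp - real qm)) \<and>
           Fm' qp qm R (of_real (s * a)) =
             of_real (s * sqrt ((real qp + 1) / (real qp * (real qm + 1))) * sgn (real qp - real qm)) \<and>
           Fp qp qm R (of_real (s * a)) =
             of_real (- s * sqrt ((real qm + 1) / (real qm * (real qp + 1))) * sgn (real qp - real qm)) \<and>
           Fp' qp qm R (of_real (s * a)) =
             of_real (- s * sqrt ((real qm + 1) / (real qm * (real qp + 1))) * sgn (real qp - real qm))) \<and>
        (qp = qm \<longrightarrow>
           (\<forall>v. odd (len v) \<longrightarrow>
              (- q) powi (- int ((len v - 1) div 2))
                * ((real qp - q) / (real qp + 1)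
                   + real qp / (real qp + 1) * (- 1 - 1 / q) * (- 1 + ratio) * ((real (len v) - 1) / 2)) = 0 \<and>
              \<phi> (of_real (s * a)) v = 0))"
        by (intro conjI allI impI)
          (rule even odd zero[THEN conjunct1] zero[THEN conjunct2] F; assumption)+
    qed
  qed
qed

end
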